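(* Let $\mathbb{G}$ be a finite graph, let $J>0$, $h\in\mathbb{R}$, $\varepsilon>0$, $\beta\in(0,\infty]$, and let $\Lambda_1\subset\Lambda_2\subset\mathbb{G}$ be finite subsets. Fix a realization $\eta\in\mathbb{R}^{V(\mathbb{G})}$ of the random field. Let $(\bar\sigma^+,\bar\sigma^-)$ be sampled from the product measure with expectation $\langle\cdot\rangle^{\partial_{\mathrm v}\Lambda_2\cup\partial_{\mathrm v}\Lambda_1,+/-}$, let $\mathcal D$ be their disagreement set, and let $\mathcal S$ be a non-anticipatory separating set such that, almost surely, $$\bar\sigma^+_{m}=\bar\sigma^-_{m}=0\quad\text{for every edge midpoint } m\in\mathcal S.$$ Then $$\mathcal T_{\Lambda_1,\Lambda_2}(\eta)\ \le\ 16J\,\big\langle\,|\mathcal S\cap\mathcal D|\,\big\rangle^{\partial_{\mathrm v}\Lambda_2\cup\partial_{\mathrm v}\Lambda_1,+/-}.$$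
   Context: $\partial_{\mathrm v}\Lambda$ is the internal vertex boundary of $\Lambda$ (vertices of $\Lambda$ with a neighbor outside $\Lambda$; for subgraphs of $\mathbb{Z}^2$, neighbors are taken in $\mathbb{Z}^2$). The boundaries $\partial_{\mathrm v}\Lambda_1$ and $\partial_{\mathrm v}\Lambda_2$ are disjoint. Ising model: $H(\sigma)=-J\sum_{\{u,v\}\in E(\mathbb{G})}\sigma_u\sigma_v-\sum_v(h+\varepsilon\eta_v)\sigma_v$ for $\sigma\in\{\pm1\}^{V(\mathbb{G})}$. Surface tension: $\mathcal T_{\Lambda_1,\Lambda_2}(\eta)=\frac1\beta\log\frac{Z^{+,+}Z^{-,-}}{Z^{+,-}Z^{-,+}}$, where $Z^{s_1,s_2}$ is the sum of $e^{-\beta H(\sigma)}$ over $\sigma\in\{\pm1\}^{V(\mathbb{G})}$ with $\sigma\equiv s_1$ on $\partial_{\mathrm v}\Lambda_1$ and $\sigma\equiv s_2$ on $\partial_{\mathrm v}\Lambda_2$. Extended model: $\bar{\mathbb{G}}$ is the graph whose vertices are $V(\mathbb{G})$ together with a midpoint $m_e$ for each $e\in E(\mathbb{G})$, with edges $\{v,m_e\}$ for $v\in e$. A configuration $\bar\sigma$ has $\bar\sigma_v=\sigma_v\in\{-1,1\}$ at vertices $v$ of $\mathbb{G}$ and $\bar\sigma_{m_e}=\kappa_{m_e}\in\{-1,0,1\}$ at midpoints, with weight $\prod_{(v,e):v\in e}W(\sigma_v,\kappa_{m_e})\cdot\exp(\beta\sum_v(h+\varepsilon\eta_v)\sigma_v)$,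 $W(a,b)=\lambda(\delta_{a,b}+t\delta_{b,0})$, $t=(e^{2J\beta}-1)^{-1/2}$, $\lambda=(2\sinh(J\beta))^{1/2}$. $\bar{\mathbb{P}}^{A,\pm}$ is the normalized measure on configurations with $\sigma\equiv\pm1$ on $A\subset V(\mathbb{G})$; $\langle\cdot\rangle^{A,+/-}$ is expectation over $(\bar\sigma^+,\bar\sigma^-)\sim\bar{\mathbb{P}}^{A,+}\otimes\bar{\mathbb{P}}^{A,-}$. For $\beta=\infty$ the measures and surface tension are defined as limits $\beta\to\infty$. The disagreement set is $\mathcal D=\{x\in\bar{\mathbb{G}}:\bar\sigma^+_x\ne\bar\sigma^-_x\}$. For a set $S\subset\bar{\mathbb{G}}$, the forward set $S_F$ is the set of $u\in\bar{\mathbb{G}}\setminus S$ from which there is a path in $\bar{\mathbb{G}}$ to $\partial_{\mathrm v}\Lambda_1$ disjoint from $S$; the backward set $S_B$ is the complement of $S_F$ in $\bar\Lambda_2$ (the extended graph of $\Lambda_2$). $S$ is separating if $\partial_{\mathrm v}\Lambda_1\subset S_F$ and $\partial_{\mathrm v}\Lambda_2\subset S_B$. A random set $\mathcal S$ (a function of $(\bar\sigma^+,\bar\sigma^-)$) is a separating set if all its values are separating, and is non-anticipatory if for every set $S$ the event $\{\mathcal S=S\}$ is measurable with respect to the restriction of $(\bar\sigma^+,\bar\sigma^-)$ to $S_B$.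
   Formalization: The finite graph G is assumed to have maximum degree at most 4 (as for subgraphs of Z^2); for arbitrary finite graphs the bound with constant 16J fails, e.g. for a star whose centre has six or more leaves. *)

theory Defs
  imports "HOL-Probability.Probability"
begin

section \<open>Graphs, boundaries and separating sets\<close>

definition simple_graph :: "'a set \<Rightarrow> 'a set set \<Rightarrow> bool" where
  "simple_graph V E \<longleftrightarrow> (\<forall>e\<in>E. e \<subseteq> V \<and> card e = 2)"

text \<open>Neighbours are taken with respect to \<open>F\<close>, the edge set of an ambient graph that may be larger
  than the graph carrying the spins (for instance that of \<open>\<int>\<^sup>2\<close>).\<close>

definition vbd :: "'a set set \<Rightarrow> 'a set \<Rightarrow> 'a set" where
  "vbd F \<Lambda> = {v \<in> \<Lambda>. \<exists>u. u \<notin> \<Lambda> \<and> {u, v} \<in> F}"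

datatype 'a xvert = Vert 'a | Mid "'a set"

definition xverts :: "'a set \<Rightarrow> 'a set set \<Rightarrow> 'a xvert set" where
  "xverts V E = Vert ` V \<union> Mid ` E"

definition xadj :: "'a set set \<Rightarrow> 'a xvert \<Rightarrow> 'a xvert \<Rightarrow> bool" where
  "xadj E x y \<longleftrightarrow> (\<exists>e\<in>E. \<exists>v\<in>e. {x, y} = {Vert v, Mid e})"

definition forward_set ::
    "'a set set \<Rightarrow> 'a set \<Rightarrow> 'a set set \<Rightarrow> 'a set \<Rightarrow> 'a xvert set \<Rightarrow> 'a xvert set" where
  "forward_set F V E \<Lambda>1 S =
     {u \<in> xverts V E - S. \<exists>p. p \<noteq> [] \<and> hd p = u \<and> last p \<in> Vert ` vbd F \<Lambda>1
        \<and> successively (xadj E) p \<and> set p \<subseteq> xverts V E - S}"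

text \<open>The extended graph of \<open>\<Lambda>2\<close> is that of the subgraph induced on \<open>\<Lambda>2\<close>.\<close>

definition backward_set ::
    "'a set set \<Rightarrow> 'a set \<Rightarrow> 'a set set \<Rightarrow> 'a set \<Rightarrow> 'a set \<Rightarrow> 'a xvert set \<Rightarrow> 'a xvert set" where
  "backward_set F V E \<Lambda>1 \<Lambda>2 S =
     xverts \<Lambda>2 {e \<in> E. e \<subseteq> \<Lambda>2} - forward_set F V E \<Lambda>1 S"

definition separating ::
    "'a set set \<Rightarrow> 'a set \<Rightarrow> 'a set set \<Rightarrow> 'a set \<Rightarrow> 'a set \<Rightarrow> 'a xvert set \<Rightarrow> bool" where
  "separating F V E \<Lambda>1 \<Lambda>2 S \<longleftrightarrow>
     S \<subseteq> xverts V E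
     \<and> Vert ` vbd F \<Lambda>1 \<subseteq> forward_set F V E \<Lambda>1 S
     \<and> Vert ` vbd F \<Lambda>2 \<subseteq> backward_set F V E \<Lambda>1 \<Lambda>2 S"

section \<open>Ising model and surface tension\<close>

text \<open>The value at inverse temperature \<open>\<beta> \<in> (0, \<infinity>]\<close> of a quantity given for finite \<open>\<beta>\<close>.\<close>

definition at_temp :: "ereal \<Rightarrow> (real \<Rightarrow> real) \<Rightarrow> real" where
  "at_temp \<beta> f = (if \<beta> = \<infinity> then Lim at_top f else f (real_of_ereal \<beta>))"

text \<open>For an edge \<open>e = {u, v}\<close> the product over \<open>e\<close> is \<open>\<sigma> u * \<sigma> v\<close>.\<close>

definition ising_energy ::
    "'a set \<Rightarrow> 'a set set \<Rightarrow> real \<Rightarrow> real \<Rightarrow> real \<Rightarrow> ('a \<Rightarrow> real) \<Rightarrow> ('a \<Rightarrow> real) \<Rightarrow> real" where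
  "ising_energy V E J h \<epsilon> \<eta> \<sigma> =
     - J * (\<Sum>e\<in>E. \<Prod>v\<in>e. \<sigma> v) - (\<Sum>v\<in>V. (h + \<epsilon> * \<eta> v) * \<sigma> v)"

definition ising_Z ::
    "'a set \<Rightarrow> 'a set set \<Rightarrow> real \<Rightarrow> real \<Rightarrow> real \<Rightarrow> ('a \<Rightarrow> real) \<Rightarrow> 'a set \<Rightarrow> 'a set
      \<Rightarrow> real \<Rightarrow> real \<Rightarrow> real \<Rightarrow> real" where
  "ising_Z V E J h \<epsilon> \<eta> B1 B2 s1 s2 b =
     (\<Sum>\<sigma> | \<sigma> \<in> (V \<rightarrow>\<^sub>E {-1, 1}) \<and> (\<forall>v\<in>B1. \<sigma> v = s1) \<and> (\<forall>v\<in>B2. \<sigma> v = s2).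
        exp (- b * ising_energy V E J h \<epsilon> \<eta> \<sigma>))"

definition surface_tension ::
    "'a set set \<Rightarrow> 'a set \<Rightarrow> 'a set set \<Rightarrow> real \<Rightarrow> real \<Rightarrow> real \<Rightarrow> ('a \<Rightarrow> real) \<Rightarrow> 'a set \<Rightarrow> 'a set
      \<Rightarrow> ereal \<Rightarrow> real" where
  "surface_tension F V E J h \<epsilon> \<eta> \<Lambda>1 \<Lambda>2 \<beta> =
     (let Z = ising_Z V E J h \<epsilon> \<eta> (vbd F \<Lambda>1) (vbd F \<Lambda>2) in
      at_temp \<beta> (\<lambda>b. 1 / b * ln ((Z 1 1 b * Z (-1) (-1) b) / (Z 1 (-1) b * Z (-1) 1 b))))"

section \<open>Extended model\<close>

definition xW :: "real \<Rightarrow> real \<Rightarrow> real \<Rightarrow> real \<Rightarrow> real" where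
  "xW J b x y =
     (2 * sinh (J * b)) powr (1 / 2)
     * (of_bool (x = y) + (exp (2 * J * b) - 1) powr (- 1 / 2) * of_bool (y = 0))"

definition xweight ::
    "'a set \<Rightarrow> 'a set set \<Rightarrow> real \<Rightarrow> real \<Rightarrow> real \<Rightarrow> ('a \<Rightarrow> real) \<Rightarrow> real \<Rightarrow> ('a xvert \<Rightarrow> real) \<Rightarrow> real" where
  "xweight V E J h \<epsilon> \<eta> b \<tau> =
     (\<Prod>e\<in>E. \<Prod>v\<in>e. xW J b (\<tau> (Vert v)) (\<tau> (Mid e)))
     * exp (b * (\<Sum>v\<in>V. (h + \<epsilon> * \<eta> v) * \<tau> (Vert v)))"

definition xconfigs :: "'a set \<Rightarrow> 'a set set \<Rightarrow> 'a set \<Rightarrow> real \<Rightarrow> ('a xvert \<Rightarrow> real) set" where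
  "xconfigs V E A s =
     {\<tau> \<in> (\<Pi>\<^sub>E x \<in> xverts V E. case x of Vert v \<Rightarrow> {-1, 1} | Mid e \<Rightarrow> {-1, 0, 1}).
        \<forall>v\<in>A. \<tau> (Vert v) = s}"

text \<open>At \<open>\<beta> = \<infinity>\<close> the limit of the measures is taken pointwise, the configuration space being finite.\<close>

definition xprob ::
    "'a set \<Rightarrow> 'a set set \<Rightarrow> real \<Rightarrow> real \<Rightarrow> real \<Rightarrow> ('a \<Rightarrow> real) \<Rightarrow> ereal \<Rightarrow> 'a set \<Rightarrow> real
      \<Rightarrow> ('a xvert \<Rightarrow> real) pmf" where
  "xprob V E J h \<epsilon> \<eta> \<beta> A s = embed_pmf (\<lambda>\<tau>.
     if \<tau> \<in> xconfigs V E A s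
     then at_temp \<beta> (\<lambda>b. xweight V E J h \<epsilon> \<eta> b \<tau> / (\<Sum>\<rho>\<in>xconfigs V E A s. xweight V E J h \<epsilon> \<eta> b \<rho>))
     else 0)"

definition xpair ::
    "'a set \<Rightarrow> 'a set set \<Rightarrow> real \<Rightarrow> real \<Rightarrow> real \<Rightarrow> ('a \<Rightarrow> real) \<Rightarrow> ereal \<Rightarrow> 'a set
      \<Rightarrow> (('a xvert \<Rightarrow> real) \<times> ('a xvert \<Rightarrow> real)) pmf" where
  "xpair V E J h \<epsilon> \<eta> \<beta> A = pair_pmf (xprob V E J h \<epsilon> \<eta> \<beta> A 1) (xprob V E J h \<epsilon> \<eta> \<beta> A (-1))"

definition xpair_space ::
    "'a set \<Rightarrow> 'a set set \<Rightarrow> 'a set \<Rightarrow> (('a xvert \<Rightarrow> real) \<times> ('a xvert \<Rightarrow> real)) set" where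
  "xpair_space V E A = xconfigs V E A 1 \<times> xconfigs V E A (-1)"

definition disagreement ::
    "'a set \<Rightarrow> 'a set set \<Rightarrow> ('a xvert \<Rightarrow> real) \<times> ('a xvert \<Rightarrow> real) \<Rightarrow> 'a xvert set" where
  "disagreement V E \<omega> = {x \<in> xverts V E. fst \<omega> x \<noteq> snd \<omega> x}"

section \<open>Non-anticipatory separating sets\<close>

definition random_separating_set ::
    "'a set set \<Rightarrow> 'a set \<Rightarrow> 'a set set \<Rightarrow> 'a set \<Rightarrow> 'a set
      \<Rightarrow> (('a xvert \<Rightarrow> real) \<times> ('a xvert \<Rightarrow> real) \<Rightarrow> 'a xvert set) \<Rightarrow> bool" where
  "random_separating_set F V E \<Lambda>1 \<Lambda>2 \<S> \<longleftrightarrow>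
     (\<forall>\<omega> \<in> xpair_space V E (vbd F \<Lambda>2 \<union> vbd F \<Lambda>1). separating F V E \<Lambda>1 \<Lambda>2 (\<S> \<omega>))"

definition restr_algebra ::
    "'a set \<Rightarrow> 'a set set \<Rightarrow> 'a set \<Rightarrow> 'a xvert set
      \<Rightarrow> (('a xvert \<Rightarrow> real) \<times> ('a xvert \<Rightarrow> real)) measure" where
  "restr_algebra V E A B =
     vimage_algebra (xpair_space V E A) (\<lambda>\<omega>. (restrict (fst \<omega>) B, restrict (snd \<omega>) B))
       (count_space UNIV)"

definition non_anticipatory ::
    "'a set set \<Rightarrow> 'a set \<Rightarrow> 'a set set \<Rightarrow> 'a set \<Rightarrow> 'a set
      \<Rightarrow> (('a xvert \<Rightarrow> real) \<times> ('a xvert \<Rightarrow> real) \<Rightarrow> 'a xvert set) \<Rightarrow> bool" where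
  "non_anticipatory F V E \<Lambda>1 \<Lambda>2 \<S> \<longleftrightarrow>
     (let A = vbd F \<Lambda>2 \<union> vbd F \<Lambda>1 in
      \<forall>S \<subseteq> xverts V E. {\<omega> \<in> xpair_space V E A. \<S> \<omega> = S}
        \<in> sets (restr_algebra V E A (backward_set F V E \<Lambda>1 \<Lambda>2 S)))"

end

theory Submission
  imports Defs
begin

text \<open>
  Exchange the two copies everywhere off the forward set. The exchanged pair has boundary values
  \<open>+\<close>, \<open>-\<close> and \<open>-\<close>, \<open>+\<close> on the two boundaries. A midpoint adjacent to
  the forward set but outside it carries 0 in both copies and so does not feel the exchange; after
  summing out the remaining midpoints near the forward set, the exchange changes an Ising energy only along
  edges leaving a vertex of the separating set at which the copies disagree. There are at most 4 such edges
  per vertex, and each costs at most \<open>2 J\<close> in each copy. As the separating set is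
  non-anticipatory, different classes of pairs are sent to disjoint sets of exchanged pairs, hence the
  expectation of \<open>exp (- 16 J \<beta> N)\<close>, with \<open>N\<close> the number of disagreements on the
  separating set, is at most \<open>exp (- \<beta> T)\<close>. Jensen's inequality gives the claim at finite
  temperature. At zero temperature the midpoint condition holds only with probability tending to 1 as
  \<open>\<beta>\<close> grows, so the inequality is restricted to that event before taking the limit.
\<close>

section \<open>Summing out midpoints\<close>

definition spin_values :: "'a xvert \<Rightarrow> real set" where
  "spin_values x = (case x of Vert v \<Rightarrow> {-1, 1} | Mid e \<Rightarrow> {-1, 0, 1})"

lemma spin_values_simps [simp]:
  "spin_values (Vert v) = {-1, 1}" "spin_values (Mid e) = {-1, 0, 1}"
  by (auto simp: spin_values_def)

lemma finite_spin_values [simp]: "finite (spin_values x)"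
  by (cases x) auto

text \<open>Given the spins, the midpoints decouple, so the distributive law turns the sum over
  midpoints into a product of single-edge sums. The admissible values \<open>R\<close> vary from
  site to site so that pinned, frozen and free sites are all covered.\<close>

lemma sum_xweight_PiE:
  assumes "finite E" and "\<And>e. e \<in> E \<Longrightarrow> finite (R (Mid e))" and "\<And>e. e \<in> E \<Longrightarrow> e \<subseteq> V"
  shows "(\<Sum>\<rho>\<in>PiE (xverts V E) R. xweight V E J h \<epsilon> \<eta> b \<rho>) =
    (\<Sum>\<sigma>\<in>PiE V (\<lambda>v. R (Vert v)). (\<Prod>e\<in>E. \<Sum>k\<in>R (Mid e). \<Prod>v\<in>e. xW J b (\<sigma> v) k)
       * exp (b * (\<Sum>v\<in>V. (h + \<epsilon> * \<eta> v) * \<sigma> v)))"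
proof -
  define field where "field \<sigma> = exp (b * (\<Sum>v\<in>V. (h + \<epsilon> * \<eta> v) * \<sigma> v))" for \<sigma> :: "'a \<Rightarrow> real"
  have "(\<Sum>\<sigma>\<in>PiE V (\<lambda>v. R (Vert v)). (\<Prod>e\<in>E. \<Sum>k\<in>R (Mid e). \<Prod>v\<in>e. xW J b (\<sigma> v) k) * field \<sigma>)
    = (\<Sum>\<sigma>\<in>PiE V (\<lambda>v. R (Vert v)). \<Sum>\<kappa>\<in>PiE E (\<lambda>e. R (Mid e)).
        (\<Prod>e\<in>E. \<Prod>v\<in>e. xW J b (\<sigma> v) (\<kappa> e)) * field \<sigma>)"
    using assms by (subst prod_sum_PiE) (simp_all add: sum_distrib_right)
  also have "\<dots> = (\<Sum>(\<sigma>, \<kappa>)\<in>PiE V (\<lambda>v. R (Vert v)) \<times> PiE E (\<lambda>e. R (Mid e)).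
        (\<Prod>e\<in>E. \<Prod>v\<in>e. xW J b (\<sigma> v) (\<kappa> e)) * field \<sigma>)"
    by (rule sum.cartesian_product)
  also have "\<dots> = (\<Sum>\<rho>\<in>PiE (xverts V E) R. xweight V E J h \<epsilon> \<eta> b \<rho>)"
  proof (rule sum.reindex_bij_witness[where
        j = "\<lambda>(\<sigma>, \<kappa>). restrict (case_xvert \<sigma> \<kappa>) (xverts V E)" and
        i = "\<lambda>\<rho>. (restrict (\<lambda>v. \<rho> (Vert v)) V, restrict (\<lambda>e. \<rho> (Mid e)) E)"], goal_cases)
    case (1 p)
    then show ?case
      by (auto simp: xverts_def PiE_def extensional_def restrict_def fun_eq_iff)
  next
    case (2 p)
    then show ?case
      by (auto simp: xverts_def PiE_def Pi_def)
  next
    case (3 \<rho>)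
    then show ?case
      by (auto simp: xverts_def PiE_def extensional_def restrict_def fun_eq_iff split: xvert.split)
  next
    case (4 \<rho>)
    then show ?case by (auto simp: xverts_def Pi_def)
  next
    case (5 p)
    have "v \<in> V" if "e \<in> E" "v \<in> e" for v e
      using assms(3)[OF that(1)] that(2) by auto
    then show ?case
      by (auto simp: xweight_def field_def xverts_def split: prod.split intro!: prod.cong sum.cong)
  qed
  finally show ?thesis unfolding field_def by simp
qed

text \<open>The square of the prefactor is \<open>exp (- J b) * (exp (2 J b) - 1)\<close>, whose
  second factor cancels against the power -1/2. As \<open>x \<noteq> 0\<close>, the delta term
  vanishes.\<close>

lemma xW_zero:
  assumes "J > 0" "b > 0" "x \<noteq> 0"
  shows "xW J b x 0 = exp (- (J * b) / 2)"
proof -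
  have *: "2 * sinh (J * b) = exp (- (J * b)) * (exp (2 * J * b) - 1)"
    by (simp add: sinh_def algebra_simps flip: exp_add)
  have pos: "exp (2 * J * b) - 1 > 0"
    using assms by simp
  have "xW J b x 0 = (exp (- (J * b)) powr (1/2) * (exp (2 * J * b) - 1) powr (1/2))
      * (exp (2 * J * b) - 1) powr (- 1/2)"
    using assms pos by (simp add: xW_def * powr_mult)
  also have "\<dots> = exp (- (J * b)) powr (1/2)"
    using assms pos by (simp add: mult.assoc flip: powr_add)
  also have "\<dots> = exp (- (J * b) / 2)"
    by (simp add: powr_def)
  finally show ?thesis .
qed

lemma xW_diag:
  assumes "J > 0" "b > 0" "y \<noteq> 0"
  shows "xW J b x y = of_bool (x = y) * sqrt (2 * sinh (J * b))"
  using assms by (simp add: xW_def powr_half_sqrt)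

lemma xW_nonneg: "J > 0 \<Longrightarrow> b > 0 \<Longrightarrow> xW J b x y \<ge> 0"
  by (simp add: xW_def)

text \<open>A zero midpoint contributes \<open>exp (- J b)\<close>. A midpoint of value 1 or -1
  contributes only if it equals both spins, and then \<open>exp (J b) - exp (- J b)\<close>. The
  total is \<open>exp (J b)\<close> for equal spins and \<open>exp (- J b)\<close> for opposite
  ones.\<close>

lemma sum_xW_midpoint:
  assumes "J > 0" "b > 0" "x \<in> {-1, 1}" "y \<in> {-1, 1}"
  shows "(\<Sum>k\<in>{-1, 0, 1}. xW J b x k * xW J b y k) = exp (J * b * (x * y))"
proof -
  have s: "2 * sinh (J * b) = exp (J * b) - exp (- (J * b))" "2 * sinh (J * b) > 0"
    using assms by (auto simp: sinh_def)
  have z: "exp (- (J * b) / 2) * exp (- (J * b) / 2) = exp (- (J * b))"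
    by (simp flip: exp_add)
  have q: "sqrt (2 * sinh (J * b)) * sqrt (2 * sinh (J * b)) = exp (J * b) - exp (- (J * b))"
    using s by simp
  show ?thesis
    using assms(3,4) z q assms(1,2) by (auto simp: xW_zero xW_diag)
qed

text \<open>Everything off \<open>F\<close> is frozen at \<open>\<tau>\<close>; the pinning to
  \<open>s\<close> on \<open>B\<close> takes effect only inside \<open>F\<close>. The form of a
  product set is what the factorisation of sums needs.\<close>

definition cylinder ::
    "'a set \<Rightarrow> 'a set set \<Rightarrow> 'a set \<Rightarrow> real \<Rightarrow> 'a xvert set \<Rightarrow> ('a xvert \<Rightarrow> real) \<Rightarrow> ('a xvert \<Rightarrow> real) set" where
  "cylinder V E B s F \<tau> = PiE (xverts V E)
     (\<lambda>x. if x \<notin> F then {\<tau> x} else if x \<in> Vert ` B then {s} else spin_values x)"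

text \<open>Two boundary values are kept apart so that the mixed boundary conditions of the
  exchanged pairs are available.\<close>

definition pinned_configs ::
    "'a set \<Rightarrow> 'a set set \<Rightarrow> 'a set \<Rightarrow> 'a set \<Rightarrow> real \<Rightarrow> real \<Rightarrow> ('a xvert \<Rightarrow> real) set" where
  "pinned_configs V E B1 B2 s1 s2 = PiE (xverts V E)
     (\<lambda>x. if x \<in> Vert ` B1 then {s1} else if x \<in> Vert ` B2 then {s2} else spin_values x)"

section \<open>The spin marginal of the extended model\<close>

locale ising_graph =
  fixes V :: "'a set" and E :: "'a set set" and J h \<epsilon> :: real and \<eta> :: "'a \<Rightarrow> real"
  assumes simple: "simple_graph V E" and finite_V: "finite V" and J_pos: "J > 0"
begin

abbreviation "weight \<equiv> xweight V E J h \<epsilon> \<eta>"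

lemma finite_E: "finite E"
  using simple finite_V by (auto simp: simple_graph_def intro: finite_subset[of E "Pow V"])

lemma edge_subset: "e \<in> E \<Longrightarrow> e \<subseteq> V"
  using simple by (auto simp: simple_graph_def)

lemma finite_edge: "e \<in> E \<Longrightarrow> finite e"
  using edge_subset finite_V finite_subset by blast

lemma finite_xverts: "finite (xverts V E)"
  using finite_V finite_E by (simp add: xverts_def)

lemma edge_cases:
  assumes "e \<in> E"
  obtains u v where "e = {u, v}" "u \<noteq> v" "u \<in> V" "v \<in> V"
  using simple assms by (auto simp: simple_graph_def card_2_iff)

lemma weight_nonneg: "b > 0 \<Longrightarrow> weight b \<tau> \<ge> 0"
  by (auto simp: xweight_def intro!: mult_nonneg_nonneg prod_nonneg xW_nonneg J_pos)

lemma sum_edge: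
  assumes "b > 0" "e \<in> E" "\<And>v. v \<in> V \<Longrightarrow> \<sigma> v \<in> {-1, 1}"
  shows "(\<Sum>k\<in>{-1, 0, 1}. \<Prod>v\<in>e. xW J b (\<sigma> v) k) = exp (J * b * (\<Prod>v\<in>e. \<sigma> v))"
proof -
  obtain u v where e: "e = {u, v}" "u \<noteq> v" "u \<in> V" "v \<in> V"
    using assms(2) by (rule edge_cases)
  have "(\<Sum>k\<in>{-1, 0, 1}. xW J b (\<sigma> u) k * xW J b (\<sigma> v) k) = exp (J * b * (\<sigma> u * \<sigma> v))"
    using assms e J_pos by (intro sum_xW_midpoint) auto
  then show ?thesis using e(1,2) by simp
qed

text \<open>The spin marginal of the extended model is the Ising model: each midpoint sum is exactly
  the Ising weight of its edge, without an extra normalising factor.\<close>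

lemma sum_pinned_configs:
  assumes b: "b > 0" and B: "B1 \<subseteq> V" "B2 \<subseteq> V" "B1 \<inter> B2 = {}" and s: "s1 \<in> {-1, 1}" "s2 \<in> {-1, 1}"
  shows "(\<Sum>\<rho>\<in>pinned_configs V E B1 B2 s1 s2. weight b \<rho>) = ising_Z V E J h \<epsilon> \<eta> B1 B2 s1 s2 b"
proof -
  define R where "R x = (if x \<in> Vert ` B1 then {s1} else if x \<in> Vert ` B2 then {s2} else spin_values x)"
    for x :: "'a xvert"
  have R: "PiE V (\<lambda>v. R (Vert v)) = {\<sigma> \<in> V \<rightarrow>\<^sub>E {-1, 1}. (\<forall>v\<in>B1. \<sigma> v = s1) \<and> (\<forall>v\<in>B2. \<sigma> v = s2)}"
  proof (intro set_eqI iffI)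
    fix \<sigma> assume \<sigma>: "\<sigma> \<in> PiE V (\<lambda>v. R (Vert v))"
    have R': "\<sigma> v \<in> R (Vert v)" if "v \<in> V" for v using \<sigma> that by auto
    have "\<sigma> v \<in> {-1, 1}" if "v \<in> V" for v
      using R'[OF that] s by (auto simp: R_def split: if_splits)
    moreover have "\<sigma> v = s1" if "v \<in> B1" for v
      using R'[of v] that B by (auto simp: R_def split: if_splits)
    moreover have "\<sigma> v = s2" if "v \<in> B2" for v
      using R'[of v] that B by (cases "v \<in> B1") (auto simp: R_def image_iff)
    ultimately show "\<sigma> \<in> {\<sigma> \<in> V \<rightarrow>\<^sub>E {-1, 1}. (\<forall>v\<in>B1. \<sigma> v = s1) \<and> (\<forall>v\<in>B2. \<sigma> v = s2)}"
      using \<sigma> by (auto simp: PiE_def Pi_def)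
  qed (auto simp: R_def PiE_def Pi_def)
  have "(\<Sum>\<rho>\<in>pinned_configs V E B1 B2 s1 s2. weight b \<rho>)
    = (\<Sum>\<sigma>\<in>PiE V (\<lambda>v. R (Vert v)). (\<Prod>e\<in>E. \<Sum>k\<in>R (Mid e). \<Prod>v\<in>e. xW J b (\<sigma> v) k)
       * exp (b * (\<Sum>v\<in>V. (h + \<epsilon> * \<eta> v) * \<sigma> v)))"
    unfolding pinned_configs_def R_def[symmetric]
    using finite_E edge_subset by (intro sum_xweight_PiE) (auto simp: R_def)
  also have "\<dots> = (\<Sum>\<sigma>\<in>PiE V (\<lambda>v. R (Vert v)). exp (- b * ising_energy V E J h \<epsilon> \<eta> \<sigma>))"
  proof (rule sum.cong[OF refl])
    fix \<sigma> assume \<sigma>: "\<sigma> \<in> PiE V (\<lambda>v. R (Vert v))"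
    have "\<sigma> v \<in> {-1, 1}" if "v \<in> V" for v
      using \<sigma> that R by (auto simp del: insert_iff)
    then have "(\<Prod>e\<in>E. \<Sum>k\<in>R (Mid e). \<Prod>v\<in>e. xW J b (\<sigma> v) k) = (\<Prod>e\<in>E. exp (J * b * (\<Prod>v\<in>e. \<sigma> v)))"
      using sum_edge[OF b, of _ \<sigma>] by (intro prod.cong) (auto simp: R_def)
    also have "\<dots> = exp (J * b * (\<Sum>e\<in>E. \<Prod>v\<in>e. \<sigma> v))"
      by (simp add: exp_sum[OF finite_E] sum_distrib_left)
    finally show "(\<Prod>e\<in>E. \<Sum>k\<in>R (Mid e). \<Prod>v\<in>e. xW J b (\<sigma> v) k)
       * exp (b * (\<Sum>v\<in>V. (h + \<epsilon> * \<eta> v) * \<sigma> v)) = exp (- b * ising_energy V E J h \<epsilon> \<eta> \<sigma>)"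
      by (simp add: ising_energy_def algebra_simps flip: exp_add)
  qed
  finally show ?thesis by (simp add: R ising_Z_def)
qed

text \<open>Spins of the free region glued to a frozen environment. Midpoints are absent because
  free ones are summed out and frozen ones are read off \<open>\<tau>\<close>.\<close>

definition merge :: "'a xvert set \<Rightarrow> ('a xvert \<Rightarrow> real) \<Rightarrow> ('a \<Rightarrow> real) \<Rightarrow> 'a \<Rightarrow> real" where
  "merge F \<tau> f v = (if Vert v \<in> F then f v else \<tau> (Vert v))"

text \<open>The weight of an edge once free midpoints are summed out: an Ising factor for a free
  midpoint, the original product for a frozen one.\<close>

definition edge_factor ::
    "real \<Rightarrow> 'a xvert set \<Rightarrow> ('a xvert \<Rightarrow> real) \<Rightarrow> ('a \<Rightarrow> real) \<Rightarrow> 'a set \<Rightarrow> real" where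
  "edge_factor b F \<tau> \<sigma> e =
     (if Mid e \<in> F then exp (J * b * (\<Prod>v\<in>e. \<sigma> v)) else \<Prod>v\<in>e. xW J b (\<sigma> v) (\<tau> (Mid e)))"

definition field :: "('a \<Rightarrow> real) \<Rightarrow> real" where
  "field \<sigma> = (\<Sum>v\<in>V. (h + \<epsilon> * \<eta> v) * \<sigma> v)"

text \<open>Indexed by the vertices of \<open>F\<close> alone, so that the same \<open>f\<close> can
  be glued to either of two frozen configurations.\<close>

definition free_spins :: "'a set \<Rightarrow> real \<Rightarrow> 'a xvert set \<Rightarrow> ('a \<Rightarrow> real) set" where
  "free_spins B s F = PiE {v \<in> V. Vert v \<in> F} (\<lambda>v. if v \<in> B then {s} else {-1, 1})"

lemma free_spins_values:
  assumes "f \<in> free_spins B s F" "s \<in> {-1, 1}" "v \<in> V" "Vert v \<in> F"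
  shows "f v \<in> {-1, 1}"
proof -
  have "f v \<in> (if v \<in> B then {s} else {-1, 1})"
    using assms(1,3,4) unfolding free_spins_def by (blast dest: PiE_mem)
  then show ?thesis using assms(2) by (auto split: if_splits)
qed

lemma merge_values:
  assumes "f \<in> free_spins B s F" "s \<in> {-1, 1}" "v \<in> V" "\<And>v. v \<in> V \<Longrightarrow> \<tau> (Vert v) \<in> {-1, 1}"
  shows "merge F \<tau> f v \<in> {-1, 1}"
  using free_spins_values[OF assms(1-3)] assms(3,4) by (auto simp: merge_def)

text \<open>Free midpoints are summed out edge by edge, and the spins of a cylinder are determined
  by their values in \<open>F\<close>, which leaves a sum over free spins.\<close>

lemma sum_cylinder:
  assumes b: "b > 0" and s: "s \<in> {-1, 1}" and \<tau>: "\<And>v. v \<in> V \<Longrightarrow> \<tau> (Vert v) \<in> {-1, 1}"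
  shows "(\<Sum>\<rho>\<in>cylinder V E B s F \<tau>. weight b \<rho>) =
    (\<Sum>f\<in>free_spins B s F. (\<Prod>e\<in>E. edge_factor b F \<tau> (merge F \<tau> f) e) * exp (b * field (merge F \<tau> f)))"
proof -
  define R where "R x = (if x \<notin> F then {\<tau> x} else if x \<in> Vert ` B then {s} else spin_values x)"
    for x :: "'a xvert"
  have "(\<Sum>\<rho>\<in>cylinder V E B s F \<tau>. weight b \<rho>)
    = (\<Sum>\<sigma>\<in>PiE V (\<lambda>v. R (Vert v)). (\<Prod>e\<in>E. \<Sum>k\<in>R (Mid e). \<Prod>v\<in>e. xW J b (\<sigma> v) k)
       * exp (b * field \<sigma>))"
    unfolding cylinder_def R_def[symmetric] field_def
    using finite_E edge_subset by (intro sum_xweight_PiE) (auto simp: R_def)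
  also have "\<dots> = (\<Sum>f\<in>free_spins B s F. (\<Prod>e\<in>E. edge_factor b F \<tau> (merge F \<tau> f) e) * exp (b * field (merge F \<tau> f)))"
  proof (rule sum.reindex_bij_witness[where
        i = "\<lambda>f. restrict (merge F \<tau> f) V" and j = "\<lambda>\<sigma>. restrict \<sigma> {v \<in> V. Vert v \<in> F}"], goal_cases)
    case (1 \<sigma>)
    then have "\<sigma> v = \<tau> (Vert v)" if "v \<in> V" "Vert v \<notin> F" for v
      using that by (auto simp: R_def dest: PiE_mem)
    moreover have "\<sigma> v = undefined" if "v \<notin> V" for v
      using 1 that by (auto simp: PiE_def extensional_def)
    ultimately show ?case by (auto simp: merge_def fun_eq_iff)
  next
    case (2 \<sigma>)
    have "\<sigma> v \<in> (if v \<in> B then {s} else {-1, 1})" if "v \<in> V" "Vert v \<in> F" for v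
    proof -
      have "\<sigma> v \<in> R (Vert v)" using 2 that(1) by (rule PiE_mem)
      then show ?thesis using that(2) by (auto simp: R_def image_iff split: if_splits)
    qed
    then show ?case by (auto simp: free_spins_def)
  next
    case (3 f)
    then show ?case by (auto simp: free_spins_def merge_def fun_eq_iff PiE_def extensional_def)
  next
    case (4 f)
    have *: "f v \<in> (if v \<in> B then {s} else {-1, 1})" if "v \<in> V" "Vert v \<in> F" for v
      using 4 that unfolding free_spins_def by (blast dest: PiE_mem)
    have "merge F \<tau> f v \<in> R (Vert v)" if "v \<in> V" for v
      using *[OF that] by (cases "Vert v \<in> F"; cases "v \<in> B") (simp_all add: merge_def R_def image_iff)
    then show ?case by simp
  next
    case (5 \<sigma>)
    have R: "\<sigma> v \<in> R (Vert v)" if "v \<in> V" for v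
      using 5 that by (rule PiE_mem)
    have \<sigma>: "merge F \<tau> (restrict \<sigma> {v \<in> V. Vert v \<in> F}) v = \<sigma> v" if "v \<in> V" for v
      using R[OF that] that by (auto simp: merge_def R_def)
    have "\<sigma> v \<in> {-1, 1}" if "v \<in> V" for v
      using R[OF that] s \<tau>[OF that] by (auto simp: R_def split: if_splits)
    then have edge: "(\<Sum>k\<in>R (Mid e). \<Prod>v\<in>e. xW J b (\<sigma> v) k) = edge_factor b F \<tau> \<sigma> e" if "e \<in> E" for e
      using sum_edge[OF b that, of \<sigma>] by (auto simp: R_def edge_factor_def)
    have "edge_factor b F \<tau> (merge F \<tau> (restrict \<sigma> {v \<in> V. Vert v \<in> F})) e = edge_factor b F \<tau> \<sigma> e"
      if "e \<in> E" for e
      using \<sigma> edge_subset[OF that] by (auto simp: edge_factor_def subset_iff intro!: prod.cong)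
    moreover have "field (merge F \<tau> (restrict \<sigma> {v \<in> V. Vert v \<in> F})) = field \<sigma>"
      using \<sigma> by (auto simp: field_def intro!: sum.cong)
    ultimately show ?case
      using edge by simp
  qed
  finally show ?thesis .
qed

section \<open>Cost of the exchange, edge by edge\<close>

lemma abs_prod_spins:
  fixes \<sigma> :: "'a \<Rightarrow> real"
  assumes "e \<in> E" "\<And>v. v \<in> V \<Longrightarrow> \<sigma> v \<in> {-1, 1}"
  shows "\<bar>\<Prod>v\<in>e. \<sigma> v\<bar> = 1"
proof -
  have "(\<Prod>v\<in>e. \<bar>\<sigma> v\<bar>) = 1"
    using assms(2) edge_subset[OF assms(1)] by (intro prod.neutral) fastforce
  then show ?thesis by (simp add: abs_prod)
qed

lemma edge_factor_nonneg: "b > 0 \<Longrightarrow> edge_factor b F \<tau> \<sigma> e \<ge> 0"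
  by (auto simp: edge_factor_def intro!: prod_nonneg xW_nonneg J_pos)

text \<open>If the midpoint is frozen, its factors at free endpoints see the value 0 in both copies
  and those at frozen endpoints merely change places, so the products are equal. If it is free and
  no endpoint lies in \<open>T\<close>, both gluings agree on \<open>e\<close>. Otherwise four spin
  products of absolute value 1 enter the exponents, which differ by at most
  \<open>4 J b\<close>.\<close>

lemma edge_factor_swap:
  assumes b: "b > 0" and e: "e \<in> E"
    and spins: "\<And>v. v \<in> V \<Longrightarrow> merge F \<tau>1 f1 v \<in> {-1, 1}" "\<And>v. v \<in> V \<Longrightarrow> merge F \<tau>2 f2 v \<in> {-1, 1}"
      "\<And>v. v \<in> V \<Longrightarrow> merge F \<tau>2 f1 v \<in> {-1, 1}" "\<And>v. v \<in> V \<Longrightarrow> merge F \<tau>1 f2 v \<in> {-1, 1}"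
    and T: "\<And>v. Mid e \<in> F \<Longrightarrow> v \<in> e \<Longrightarrow> Vert v \<notin> F \<Longrightarrow> \<tau>1 (Vert v) \<noteq> \<tau>2 (Vert v) \<Longrightarrow> Vert v \<in> T"
    and zero: "\<And>v. Mid e \<notin> F \<Longrightarrow> v \<in> e \<Longrightarrow> Vert v \<in> F \<Longrightarrow> \<tau>1 (Mid e) = 0 \<and> \<tau>2 (Mid e) = 0"
  shows "edge_factor b F \<tau>1 (merge F \<tau>1 f1) e * edge_factor b F \<tau>2 (merge F \<tau>2 f2) e
    \<le> exp (4 * J * b * card {v \<in> e. Vert v \<in> T})
      * (edge_factor b F \<tau>2 (merge F \<tau>2 f1) e * edge_factor b F \<tau>1 (merge F \<tau>1 f2) e)"
    (is "?L \<le> exp ?c * ?R")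
proof -
  have c: "?c \<ge> 0" using J_pos b by simp
  have R: "?R \<ge> 0" using b by (simp add: edge_factor_nonneg)
  have *: ?thesis if "?L = ?R"
    using mult_right_mono[OF _ R, of 1 "exp ?c"] c that by simp
  show ?thesis
  proof (cases "Mid e \<in> F")
    case False
    have "?L = (\<Prod>v\<in>e. xW J b (merge F \<tau>1 f1 v) (\<tau>1 (Mid e)) * xW J b (merge F \<tau>2 f2 v) (\<tau>2 (Mid e)))"
      using False by (simp add: edge_factor_def prod.distrib)
    also have "\<dots> = (\<Prod>v\<in>e. xW J b (merge F \<tau>2 f1 v) (\<tau>2 (Mid e)) * xW J b (merge F \<tau>1 f2 v) (\<tau>1 (Mid e)))"
      using zero[OF False] by (intro prod.cong) (auto simp: merge_def)
    also have "\<dots> = ?R"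
      using False by (simp add: edge_factor_def prod.distrib)
    finally show ?thesis by (rule *)
  next
    case True
    show ?thesis
    proof (cases "\<exists>v\<in>e. Vert v \<in> T")
      case False
      have "merge F \<tau>1 f v = merge F \<tau>2 f v" if "v \<in> e" for f v
        using T[OF True that] False that by (auto simp: merge_def)
      then have "edge_factor b F \<tau>1 (merge F \<tau>1 f) e = edge_factor b F \<tau>2 (merge F \<tau>2 f) e" for f
        using True by (auto simp: edge_factor_def)
      then show ?thesis by (intro *) metis
    next
      case ex: True
      \<comment> \<open>A single endpoint in \<open>T\<close> already pays for the whole
        \<open>4 J b\<close>.\<close>
      then have "card {v \<in> e. Vert v \<in> T} \<noteq> 0"
        using finite_edge[OF e] by auto
      then have "J * b * real (card {v \<in> e. Vert v \<in> T}) \<ge> J * b * 1"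
        using J_pos b by (intro mult_left_mono) auto
      moreover have "J * b * (prod (merge F \<tau>1 f1) e + prod (merge F \<tau>2 f2) e
            - prod (merge F \<tau>2 f1) e - prod (merge F \<tau>1 f2) e) \<le> J * b * 4"
      proof (rule mult_left_mono)
        have "\<bar>prod (merge F \<tau>1 f1) e\<bar> = 1" "\<bar>prod (merge F \<tau>2 f2) e\<bar> = 1"
          "\<bar>prod (merge F \<tau>2 f1) e\<bar> = 1" "\<bar>prod (merge F \<tau>1 f2) e\<bar> = 1"
          by (intro abs_prod_spins e spins; assumption)+
        then show "prod (merge F \<tau>1 f1) e + prod (merge F \<tau>2 f2) e
            - prod (merge F \<tau>2 f1) e - prod (merge F \<tau>1 f2) e \<le> 4"
          by linarith
      qed (use J_pos b in simp)
      ultimately have "J * b * prod (merge F \<tau>1 f1) e + J * b * prod (merge F \<tau>2 f2) e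
          \<le> ?c + (J * b * prod (merge F \<tau>2 f1) e + J * b * prod (merge F \<tau>1 f2) e)"
        by (simp add: algebra_simps)
      then show ?thesis
        using True by (simp add: edge_factor_def flip: exp_add)
    qed
  qed
qed

text \<open>Double counting of incidences: each vertex of \<open>T\<close> lies on at most
  \<open>\<Delta>\<close> edges, and midpoints in \<open>T\<close> only enlarge the right-hand
  side.\<close>

lemma sum_card_edges_le:
  assumes "\<And>v. v \<in> V \<Longrightarrow> card {e \<in> E. v \<in> e} \<le> \<Delta>" "finite T"
  shows "(\<Sum>e\<in>E. card {v \<in> e. Vert v \<in> T}) \<le> \<Delta> * card T"
proof -
  have "card {v \<in> e. Vert v \<in> T} = (\<Sum>v\<in>{v \<in> V. Vert v \<in> T}. of_bool (v \<in> e))" if "e \<in> E" for e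
  proof -
    have "{v \<in> e. Vert v \<in> T} = {v \<in> {v \<in> V. Vert v \<in> T}. v \<in> e}"
      using edge_subset[OF that] by auto
    then show ?thesis
      using finite_V by (simp add: sum.If_cases of_bool_def Int_def)
  qed
  then have "(\<Sum>e\<in>E. card {v \<in> e. Vert v \<in> T}) = (\<Sum>e\<in>E. \<Sum>v\<in>{v \<in> V. Vert v \<in> T}. of_bool (v \<in> e))"
    by simp
  also have "\<dots> = (\<Sum>v\<in>{v \<in> V. Vert v \<in> T}. card {e \<in> E. v \<in> e})"
    using finite_E by (subst sum.swap) (simp add: sum.If_cases of_bool_def Int_def)
  also have "\<dots> \<le> (\<Sum>v\<in>{v \<in> V. Vert v \<in> T}. \<Delta>)"
    using assms(1) by (intro sum_mono) auto
  also have "\<dots> = \<Delta> * card (Vert ` {v \<in> V. Vert v \<in> T})"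
    by (simp add: card_image inj_on_def)
  also have "\<dots> \<le> \<Delta> * card T"
    using assms(2) by (intro mult_left_mono card_mono) auto
  finally show ?thesis .
qed

text \<open>Exchanging the boundary conditions seen by the free region costs at most \<open>2 J b\<close> per copy and edge
  leaving a disagreement, because midpoints separating a free vertex from the frozen part vanish.\<close>

lemma sum_cylinder_swap:
  assumes b: "b > 0" and s: "s1 \<in> {-1, 1}" "s2 \<in> {-1, 1}"
    and \<tau>: "\<And>v. v \<in> V \<Longrightarrow> \<tau>1 (Vert v) \<in> {-1, 1}" "\<And>v. v \<in> V \<Longrightarrow> \<tau>2 (Vert v) \<in> {-1, 1}"
    and degree: "\<And>v. v \<in> V \<Longrightarrow> card {e \<in> E. v \<in> e} \<le> \<Delta>" and fin: "finite T"
    and T: "\<And>e v. e \<in> E \<Longrightarrow> Mid e \<in> F \<Longrightarrow> v \<in> e \<Longrightarrow> Vert v \<notin> F \<Longrightarrow> \<tau>1 (Vert v) \<noteq> \<tau>2 (Vert v) \<Longrightarrow> Vert v \<in> T"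
    and zero: "\<And>e v. e \<in> E \<Longrightarrow> Mid e \<notin> F \<Longrightarrow> v \<in> e \<Longrightarrow> Vert v \<in> F \<Longrightarrow> \<tau>1 (Mid e) = 0 \<and> \<tau>2 (Mid e) = 0"
  shows "sum (weight b) (cylinder V E B s1 F \<tau>1) * sum (weight b) (cylinder V E B s2 F \<tau>2)
    \<le> exp (4 * J * b * \<Delta> * card T)
      * (sum (weight b) (cylinder V E B s1 F \<tau>2) * sum (weight b) (cylinder V E B s2 F \<tau>1))"
proof -
  define g where "g \<tau> f = (\<Prod>e\<in>E. edge_factor b F \<tau> (merge F \<tau> f) e) * exp (b * field (merge F \<tau> f))"
    for \<tau> f
  have cyl: "sum (weight b) (cylinder V E B s F \<tau>) = sum (g \<tau>) (free_spins B s F)"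
    if "s \<in> {-1, 1}" "\<And>v. v \<in> V \<Longrightarrow> \<tau> (Vert v) \<in> {-1, 1}" for s \<tau>
    unfolding g_def by (rule sum_cylinder) (use b that in blast)+
  have "g \<tau>1 f1 * g \<tau>2 f2 \<le> exp (4 * J * b * \<Delta> * card T) * (g \<tau>2 f1 * g \<tau>1 f2)"
    if f1: "f1 \<in> free_spins B s1 F" and f2: "f2 \<in> free_spins B s2 F" for f1 f2
  proof -
    have "(\<Prod>e\<in>E. edge_factor b F \<tau>1 (merge F \<tau>1 f1) e * edge_factor b F \<tau>2 (merge F \<tau>2 f2) e)
      \<le> (\<Prod>e\<in>E. exp (4 * J * b * card {v \<in> e. Vert v \<in> T})
        * (edge_factor b F \<tau>2 (merge F \<tau>2 f1) e * edge_factor b F \<tau>1 (merge F \<tau>1 f2) e))"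
      using T zero
      by (intro prod_mono conjI edge_factor_swap b mult_nonneg_nonneg edge_factor_nonneg
          merge_values[OF f1 s(1)] merge_values[OF f2 s(2)] \<tau>) auto
    also have "\<dots> = exp (4 * J * b * real (\<Sum>e\<in>E. card {v \<in> e. Vert v \<in> T}))
        * (\<Prod>e\<in>E. edge_factor b F \<tau>2 (merge F \<tau>2 f1) e * edge_factor b F \<tau>1 (merge F \<tau>1 f2) e)"
      by (simp add: prod.distrib exp_sum[OF finite_E] sum_distrib_left)
    also have "\<dots> \<le> exp (4 * J * b * real (\<Delta> * card T))
        * (\<Prod>e\<in>E. edge_factor b F \<tau>2 (merge F \<tau>2 f1) e * edge_factor b F \<tau>1 (merge F \<tau>1 f2) e)"
      using sum_card_edges_le[OF degree fin] J_pos b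
      by (intro mult_right_mono prod_nonneg ballI mult_nonneg_nonneg edge_factor_nonneg)
        (auto intro!: mult_left_mono simp del: of_nat_sum of_nat_mult)
    finally have edges: "(\<Prod>e\<in>E. edge_factor b F \<tau>1 (merge F \<tau>1 f1) e) * (\<Prod>e\<in>E. edge_factor b F \<tau>2 (merge F \<tau>2 f2) e)
      \<le> exp (4 * J * b * \<Delta> * card T) * ((\<Prod>e\<in>E. edge_factor b F \<tau>2 (merge F \<tau>2 f1) e)
        * (\<Prod>e\<in>E. edge_factor b F \<tau>1 (merge F \<tau>1 f2) e))"
      by (simp add: prod.distrib mult.assoc)
    \<comment> \<open>At each vertex the exchange at most permutes the two spins between the copies,
      so the total field term is unchanged.\<close>
    have "field (merge F \<tau>1 f1) + field (merge F \<tau>2 f2) = field (merge F \<tau>2 f1) + field (merge F \<tau>1 f2)"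
      unfolding field_def sum.distrib[symmetric] by (intro sum.cong) (auto simp: merge_def)
    then have "exp (b * field (merge F \<tau>1 f1)) * exp (b * field (merge F \<tau>2 f2))
      = exp (b * field (merge F \<tau>2 f1)) * exp (b * field (merge F \<tau>1 f2))"
      by (metis exp_add distrib_left)
    then have fields: "g \<tau>1 f1 * g \<tau>2 f2 = ((\<Prod>e\<in>E. edge_factor b F \<tau>1 (merge F \<tau>1 f1) e)
        * (\<Prod>e\<in>E. edge_factor b F \<tau>2 (merge F \<tau>2 f2) e))
        * (exp (b * field (merge F \<tau>2 f1)) * exp (b * field (merge F \<tau>1 f2)))"
      by (simp add: g_def)
    show ?thesis
      unfolding fields using mult_right_mono[OF edges, of "exp (b * field (merge F \<tau>2 f1)) * exp (b * field (merge F \<tau>1 f2))"]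
      by (simp add: g_def mult_ac)
  qed
  then have "sum (g \<tau>1) (free_spins B s1 F) * sum (g \<tau>2) (free_spins B s2 F)
    \<le> exp (4 * J * b * \<Delta> * card T) * (sum (g \<tau>2) (free_spins B s1 F) * sum (g \<tau>1) (free_spins B s2 F))"
    unfolding sum_product unfolding sum_distrib_left by (intro sum_mono)
  then show ?thesis
    using s \<tau> by (simp only: cyl)
qed

end

section \<open>Exchanging the two copies\<close>

lemma forward_set_subset: "forward_set F V E \<Lambda>1 S \<subseteq> xverts V E - S"
  by (auto simp: forward_set_def)

text \<open>Prepending \<open>y\<close> to the path of \<open>x\<close> gives a path of
  \<open>y\<close>. By contraposition, every site adjacent to the forward set but not in it belongs
  to \<open>S\<close>.\<close>

lemma forward_set_step:
  assumes "x \<in> forward_set F V E \<Lambda>1 S" "xadj E y x" "y \<in> xverts V E" "y \<notin> S"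
  shows "y \<in> forward_set F V E \<Lambda>1 S"
proof -
  obtain p where p: "p \<noteq> []" "hd p = x" "last p \<in> Vert ` vbd F \<Lambda>1"
      "successively (xadj E) p" "set p \<subseteq> xverts V E - S"
    using assms(1) by (auto simp: forward_set_def)
  have "successively (xadj E) (y # p)"
    using p assms(2) by (cases p) auto
  then show ?thesis
    using p assms by (auto simp: forward_set_def intro!: exI[of _ "y # p"])
qed

lemma xadj_midpoint: "e \<in> E \<Longrightarrow> v \<in> e \<Longrightarrow> xadj E (Vert v) (Mid e) \<and> xadj E (Mid e) (Vert v)"
  unfolding xadj_def by (auto simp: insert_commute)

lemma PiE_Collect_iff:
  "f \<in> (\<Pi>\<^sub>E x\<in>A. {y \<in> B x. P x y}) \<longleftrightarrow> f \<in> PiE A B \<and> (\<forall>x\<in>A. P x (f x))"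
  by (auto simp: PiE_iff)

lemma xconfigs_alt:
  assumes "B1 \<union> B2 = A" "A \<subseteq> V" "s \<in> {-1, 1}"
  shows "xconfigs V E A s = pinned_configs V E B1 B2 s s"
proof -
  have A: "Vert v \<in> xverts V E" if "v \<in> A" for v
    using that assms(2) by (auto simp: xverts_def)
  have 1: "(\<Pi>\<^sub>E x \<in> xverts V E. case x of Vert v \<Rightarrow> {-1, 1} | Mid e \<Rightarrow> {-1, 0, 1}) = PiE (xverts V E) spin_values"
    by (rule PiE_cong) (simp add: spin_values_def)
  have 2: "(if x \<in> Vert ` B1 then {s} else if x \<in> Vert ` B2 then {s} else spin_values x)
      = {y \<in> spin_values x. x \<in> Vert ` A \<longrightarrow> y = s}" for x :: "'a xvert"
    using assms by (cases x) auto
  show ?thesis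
    unfolding xconfigs_def pinned_configs_def 1 2
    by (simp only: set_eq_iff mem_Collect_eq PiE_Collect_iff) (use A in blast)
qed

text \<open>Measurability with respect to a restriction map means that the event is a preimage under
  this map, so two pairs with the same restriction lie both inside or both outside. This is applied
  to the event that the random set takes the value \<open>\<S> \<omega>\<close>.\<close>

lemma non_anticipatoryD:
  fixes \<S> :: "('a xvert \<Rightarrow> real) \<times> ('a xvert \<Rightarrow> real) \<Rightarrow> 'a xvert set"
  assumes "non_anticipatory F V E \<Lambda>1 \<Lambda>2 \<S>"
    and "\<omega> \<in> xpair_space V E (vbd F \<Lambda>2 \<union> vbd F \<Lambda>1)" "\<omega>' \<in> xpair_space V E (vbd F \<Lambda>2 \<union> vbd F \<Lambda>1)"
    and "\<S> \<omega> \<subseteq> xverts V E"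
    and eq: "\<And>x. x \<in> backward_set F V E \<Lambda>1 \<Lambda>2 (\<S> \<omega>) \<Longrightarrow> fst \<omega>' x = fst \<omega> x \<and> snd \<omega>' x = snd \<omega> x"
  shows "\<S> \<omega>' = \<S> \<omega>"
proof -
  let ?B = "backward_set F V E \<Lambda>1 \<Lambda>2 (\<S> \<omega>)"
  let ?X = "xpair_space V E (vbd F \<Lambda>2 \<union> vbd F \<Lambda>1)"
  let ?r = "\<lambda>\<omega> :: ('a xvert \<Rightarrow> real) \<times> ('a xvert \<Rightarrow> real). (restrict (fst \<omega>) ?B, restrict (snd \<omega>) ?B)"
  have "{\<omega>' \<in> ?X. \<S> \<omega>' = \<S> \<omega>} \<in> sets (vimage_algebra ?X ?r (count_space UNIV))"
    using assms(1,4) by (auto simp: non_anticipatory_def restr_algebra_def Let_def)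
  then obtain T where T: "{\<omega>' \<in> ?X. \<S> \<omega>' = \<S> \<omega>} = ?r -` T \<inter> ?X"
    by (auto simp: sets_vimage_algebra2)
  have "?r \<omega> = ?r \<omega>'"
    using eq by (auto simp: restrict_def fun_eq_iff)
  moreover have "\<omega> \<in> ?r -` T \<inter> ?X"
    using T assms(2) by blast
  ultimately have "\<omega>' \<in> ?r -` T \<inter> ?X"
    using assms(3) by simp
  then show ?thesis using T by blast
qed

section \<open>Pairs of copies with a separating set\<close>

locale separated_pair = ising_graph V E J h \<epsilon> \<eta>
  for V :: "'a set" and E :: "'a set set" and J h \<epsilon> :: real and \<eta> :: "'a \<Rightarrow> real" +
  fixes F :: "'a set set" and \<Lambda>1 \<Lambda>2 :: "'a set" and \<Delta> :: nat
    and \<S> :: "('a xvert \<Rightarrow> real) \<times> ('a xvert \<Rightarrow> real) \<Rightarrow> 'a xvert set"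
  assumes degree: "\<And>v. v \<in> V \<Longrightarrow> card {e \<in> E. v \<in> e} \<le> \<Delta>"
    and subsets: "\<Lambda>1 \<subseteq> V" "\<Lambda>2 \<subseteq> V"
    and disjoint: "vbd F \<Lambda>1 \<inter> vbd F \<Lambda>2 = {}"
    and separating: "random_separating_set F V E \<Lambda>1 \<Lambda>2 \<S>"
    and non_anticipatory: "non_anticipatory F V E \<Lambda>1 \<Lambda>2 \<S>"
begin

abbreviation "B1 \<equiv> vbd F \<Lambda>1"
abbreviation "B2 \<equiv> vbd F \<Lambda>2"
abbreviation "pairs \<equiv> xpair_space V E (B2 \<union> B1)"
abbreviation "fwd \<omega> \<equiv> forward_set F V E \<Lambda>1 (\<S> \<omega>)"
abbreviation "Z \<equiv> ising_Z V E J h \<epsilon> \<eta> B1 B2"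

text \<open>The midpoint condition imposed pointwise. At zero temperature it is known only under the
  limit measure, so the estimates at finite \<open>b\<close> are restricted to this set.\<close>

definition good_pairs :: "(('a xvert \<Rightarrow> real) \<times> ('a xvert \<Rightarrow> real)) set" where
  "good_pairs = {\<omega> \<in> pairs. \<forall>e. Mid e \<in> \<S> \<omega> \<longrightarrow> fst \<omega> (Mid e) = 0 \<and> snd \<omega> (Mid e) = 0}"

definition cost :: "('a xvert \<Rightarrow> real) \<times> ('a xvert \<Rightarrow> real) \<Rightarrow> nat" where
  "cost \<omega> = card (\<S> \<omega> \<inter> disagreement V E \<omega>)"

text \<open>The identity of the class of pairs that agree with \<open>\<omega>\<close> off the forward set.\<close>

definition frozen :: "('a xvert \<Rightarrow> real) \<times> ('a xvert \<Rightarrow> real)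
    \<Rightarrow> 'a xvert set \<times> ('a xvert \<Rightarrow> real) \<times> ('a xvert \<Rightarrow> real)" where
  "frozen \<omega> = (\<S> \<omega>, restrict (fst \<omega>) (xverts V E - fwd \<omega>), restrict (snd \<omega>) (xverts V E - fwd \<omega>))"

lemma boundary_subset: "B1 \<subseteq> V" "B2 \<subseteq> V"
  using subsets by (auto simp: vbd_def)

lemma pairs_eq: "pairs = pinned_configs V E B1 B2 1 1 \<times> pinned_configs V E B1 B2 (-1) (-1)"
  unfolding xpair_space_def using boundary_subset
  by (intro arg_cong2[of _ _ _ _ "(\<times>)"] xconfigs_alt) auto

lemma finite_pinned: "finite (pinned_configs V E B1 B2 s1 s2)"
  unfolding pinned_configs_def using finite_xverts by (intro finite_PiE) auto

lemma finite_pairs: "finite pairs"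
  by (simp add: pairs_eq finite_pinned)

lemma pinned_iff:
  assumes "s1 \<in> {-1, 1}" "s2 \<in> {-1, 1}"
  shows "\<rho> \<in> pinned_configs V E B1 B2 s1 s2 \<longleftrightarrow> \<rho> \<in> extensional (xverts V E)
    \<and> (\<forall>x\<in>xverts V E. \<rho> x \<in> spin_values x) \<and> (\<forall>v\<in>B1. \<rho> (Vert v) = s1) \<and> (\<forall>v\<in>B2. \<rho> (Vert v) = s2)"
proof -
  have B: "Vert v \<in> xverts V E" if "v \<in> B1 \<union> B2" for v
    using that boundary_subset by (auto simp: xverts_def)
  have "(if x \<in> Vert ` B1 then {s1} else if x \<in> Vert ` B2 then {s2} else spin_values x)
      = {y \<in> spin_values x. (x \<in> Vert ` B1 \<longrightarrow> y = s1) \<and> (x \<in> Vert ` B2 \<longrightarrow> y = s2)}" for x :: "'a xvert"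
    using assms disjoint by (cases x) auto
  then show ?thesis
    unfolding pinned_configs_def by (simp only: PiE_Collect_iff PiE_iff) (use B in blast)
qed

lemma separatingD:
  assumes "\<omega> \<in> pairs"
  shows "\<S> \<omega> \<subseteq> xverts V E" "Vert ` B1 \<subseteq> fwd \<omega>" "Vert ` B2 \<inter> fwd \<omega> = {}" "fwd \<omega> \<subseteq> xverts V E - \<S> \<omega>"
proof -
  have "separating F V E \<Lambda>1 \<Lambda>2 (\<S> \<omega>)"
    using assms separating by (simp add: random_separating_set_def)
  then show "\<S> \<omega> \<subseteq> xverts V E" "Vert ` B1 \<subseteq> fwd \<omega>" "Vert ` B2 \<inter> fwd \<omega> = {}"
    by (auto simp: separating_def backward_set_def)
qed (rule forward_set_subset)

text \<open>Agreement off the forward set contains agreement on the backward set, so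
  non-anticipation forces the same separating set, hence the same forward set and the same
  label.\<close>

lemma frozen_eqI:
  assumes "\<omega> \<in> pairs" "\<omega>' \<in> pairs"
    and "\<And>x. x \<in> xverts V E - fwd \<omega> \<Longrightarrow> fst \<omega>' x = fst \<omega> x \<and> snd \<omega>' x = snd \<omega> x"
  shows "\<S> \<omega>' = \<S> \<omega>" "frozen \<omega>' = frozen \<omega>"
proof -
  have "backward_set F V E \<Lambda>1 \<Lambda>2 (\<S> \<omega>) \<subseteq> xverts V E - fwd \<omega>"
    using subsets by (auto simp: backward_set_def xverts_def)
  then show *: "\<S> \<omega>' = \<S> \<omega>"
    using assms separatingD(1)[OF assms(1)]
    by (intro non_anticipatoryD[OF non_anticipatory assms(1,2)]) blast+
  have "restrict (fst \<omega>') (xverts V E - fwd \<omega>) = restrict (fst \<omega>) (xverts V E - fwd \<omega>)"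
    "restrict (snd \<omega>') (xverts V E - fwd \<omega>) = restrict (snd \<omega>) (xverts V E - fwd \<omega>)"
    using assms(3) by (blast intro: restrict_ext)+
  then show "frozen \<omega>' = frozen \<omega>"
    by (simp only: frozen_def *)
qed

lemma frozen_eqD:
  assumes "frozen \<omega> = frozen \<omega>'"
  shows "\<S> \<omega> = \<S> \<omega>'" "\<And>x. x \<in> xverts V E - fwd \<omega> \<Longrightarrow> fst \<omega>' x = fst \<omega> x \<and> snd \<omega>' x = snd \<omega> x"
proof -
  show *: "\<S> \<omega> = \<S> \<omega>'" using assms by (simp add: frozen_def)
  show "fst \<omega>' x = fst \<omega> x \<and> snd \<omega>' x = snd \<omega> x" if "x \<in> xverts V E - fwd \<omega>" for x
  proof -
    have "restrict (fst \<omega>') (xverts V E - fwd \<omega>) x = restrict (fst \<omega>) (xverts V E - fwd \<omega>) x"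
      "restrict (snd \<omega>') (xverts V E - fwd \<omega>) x = restrict (snd \<omega>) (xverts V E - fwd \<omega>) x"
      using assms by (simp_all only: frozen_def * prod.inject)
    then show ?thesis using that by (simp only: restrict_apply')
  qed
qed

section \<open>Classes of pairs and their exchanged images\<close>

definition fiber where
  "fiber \<omega> = cylinder V E B1 1 (fwd \<omega>) (fst \<omega>) \<times> cylinder V E B1 (-1) (fwd \<omega>) (snd \<omega>)"

definition swapped_fiber where
  "swapped_fiber \<omega> = cylinder V E B1 1 (fwd \<omega>) (snd \<omega>) \<times> cylinder V E B1 (-1) (fwd \<omega>) (fst \<omega>)"

lemma finite_cylinder: "finite (cylinder V E B s F' \<tau>)"
  unfolding cylinder_def using finite_xverts by (intro finite_PiE) auto

lemma pairs_iff:
  "\<omega> \<in> pairs \<longleftrightarrow> fst \<omega> \<in> extensional (xverts V E) \<and> snd \<omega> \<in> extensional (xverts V E)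
    \<and> (\<forall>x\<in>xverts V E. fst \<omega> x \<in> spin_values x \<and> snd \<omega> x \<in> spin_values x)
    \<and> (\<forall>v\<in>B1 \<union> B2. fst \<omega> (Vert v) = 1 \<and> snd \<omega> (Vert v) = -1)"
  by (cases \<omega>) (auto simp: pairs_eq pinned_iff)

text \<open>The inner boundary lies inside the forward set and the outer one outside, so the
  cylinder fixes the former through \<open>s1\<close> and the latter through
  \<open>\<tau>\<close>.\<close>

lemma cylinder_iff:
  assumes "\<omega> \<in> pairs" and \<tau>: "\<And>x. x \<in> xverts V E \<Longrightarrow> \<tau> x \<in> spin_values x" "\<And>v. v \<in> B2 \<Longrightarrow> \<tau> (Vert v) = s2"
  shows "\<rho> \<in> cylinder V E B1 s1 (fwd \<omega>) \<tau> \<longleftrightarrow>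
    \<rho> \<in> pinned_configs V E B1 B2 s1 s2 \<and> (\<forall>x\<in>xverts V E - fwd \<omega>. \<rho> x = \<tau> x)"
proof -
  have "(if x \<notin> fwd \<omega> then {\<tau> x} else if x \<in> Vert ` B1 then {s1} else spin_values x)
      = {y \<in> (if x \<in> Vert ` B1 then {s1} else if x \<in> Vert ` B2 then {s2} else spin_values x). x \<notin> fwd \<omega> \<longrightarrow> y = \<tau> x}"
    if "x \<in> xverts V E" for x
  proof (cases "x \<in> fwd \<omega>")
    case True
    then have "x \<notin> Vert ` B2" using separatingD(3)[OF assms(1)] by blast
    then show ?thesis using True by simp
  next
    case False
    then have "x \<notin> Vert ` B1" using separatingD(2)[OF assms(1)] by blast
    then show ?thesis using False \<tau>(1)[OF that] \<tau>(2) by auto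
  qed
  then have "cylinder V E B1 s1 (fwd \<omega>) \<tau> = PiE (xverts V E) (\<lambda>x. {y \<in> (if x \<in> Vert ` B1 then {s1}
      else if x \<in> Vert ` B2 then {s2} else spin_values x). x \<notin> fwd \<omega> \<longrightarrow> y = \<tau> x})"
    unfolding cylinder_def by (rule PiE_cong)
  then show ?thesis
    unfolding pinned_configs_def by (simp only: PiE_Collect_iff) blast
qed

lemma fiber_iff:
  assumes "\<omega> \<in> pairs"
  shows "\<omega>' \<in> fiber \<omega> \<longleftrightarrow> \<omega>' \<in> pairs \<and> (\<forall>x\<in>xverts V E - fwd \<omega>. fst \<omega>' x = fst \<omega> x \<and> snd \<omega>' x = snd \<omega> x)"
proof -
  have "\<rho> \<in> cylinder V E B1 1 (fwd \<omega>) (fst \<omega>) \<longleftrightarrow>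
      \<rho> \<in> pinned_configs V E B1 B2 1 1 \<and> (\<forall>x\<in>xverts V E - fwd \<omega>. \<rho> x = fst \<omega> x)" for \<rho>
    using assms by (intro cylinder_iff) (auto simp: pairs_iff)
  moreover have "\<rho> \<in> cylinder V E B1 (-1) (fwd \<omega>) (snd \<omega>) \<longleftrightarrow>
      \<rho> \<in> pinned_configs V E B1 B2 (-1) (-1) \<and> (\<forall>x\<in>xverts V E - fwd \<omega>. \<rho> x = snd \<omega> x)" for \<rho>
    using assms by (intro cylinder_iff) (auto simp: pairs_iff)
  ultimately show ?thesis
    by (cases \<omega>') (simp add: fiber_def pairs_eq, blast)
qed

lemma swapped_fiber_iff:
  assumes "\<omega> \<in> pairs"
  shows "\<omega>' \<in> swapped_fiber \<omega> \<longleftrightarrow>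
    \<omega>' \<in> pinned_configs V E B1 B2 1 (-1) \<times> pinned_configs V E B1 B2 (-1) 1
    \<and> (\<forall>x\<in>xverts V E - fwd \<omega>. fst \<omega>' x = snd \<omega> x \<and> snd \<omega>' x = fst \<omega> x)"
proof -
  have "\<rho> \<in> cylinder V E B1 1 (fwd \<omega>) (snd \<omega>) \<longleftrightarrow>
      \<rho> \<in> pinned_configs V E B1 B2 1 (-1) \<and> (\<forall>x\<in>xverts V E - fwd \<omega>. \<rho> x = snd \<omega> x)" for \<rho>
    using assms by (intro cylinder_iff) (auto simp: pairs_iff)
  moreover have "\<rho> \<in> cylinder V E B1 (-1) (fwd \<omega>) (fst \<omega>) \<longleftrightarrow>
      \<rho> \<in> pinned_configs V E B1 B2 (-1) 1 \<and> (\<forall>x\<in>xverts V E - fwd \<omega>. \<rho> x = fst \<omega> x)" for \<rho>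
    using assms by (intro cylinder_iff) (auto simp: pairs_iff)
  ultimately show ?thesis
    by (cases \<omega>') (simp add: swapped_fiber_def, blast)
qed

text \<open>Undoing the two swaps simultaneously, that is on the union of the two frozen regions, gives a pair
  that the non-anticipatory set cannot distinguish from either of the two originals.\<close>

lemma swapped_fiber_disjoint:
  assumes \<omega>: "\<omega>1 \<in> pairs" "\<omega>2 \<in> pairs" and \<rho>: "\<rho> \<in> swapped_fiber \<omega>1" "\<rho> \<in> swapped_fiber \<omega>2"
  shows "frozen \<omega>1 = frozen \<omega>2"
proof -
  define C where "C = (xverts V E - fwd \<omega>1) \<union> (xverts V E - fwd \<omega>2)"
  define \<omega> where "\<omega> = (\<lambda>x. if x \<in> C then snd \<rho> x else fst \<rho> x, \<lambda>x. if x \<in> C then fst \<rho> x else snd \<rho> x)"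
  have pin: "fst \<rho> \<in> pinned_configs V E B1 B2 1 (-1)" "snd \<rho> \<in> pinned_configs V E B1 B2 (-1) 1"
    using \<rho>(1) \<omega>(1) by (auto simp: swapped_fiber_iff)
  \<comment> \<open>The exchange on \<open>C\<close> leaves the inner boundary alone and covers the
    outer one, so each copy in \<open>\<omega>\<close> has one constant value on both boundaries and
    \<open>\<omega>\<close> lies in \<open>pairs\<close>.\<close>
  have B: "Vert v \<notin> C" if "v \<in> B1" for v
    using separatingD(2)[OF \<omega>(1)] separatingD(2)[OF \<omega>(2)] that by (auto simp: C_def)
  have B': "Vert v \<in> C" if "v \<in> B2" for v
    using separatingD(3)[OF \<omega>(1)] that boundary_subset by (auto simp: C_def xverts_def)
  have "\<omega> \<in> pairs"
    unfolding pairs_iff using pin B B' by (auto simp: \<omega>_def pinned_iff extensional_def)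
  moreover have "fst \<omega> x = fst \<omega>1 x \<and> snd \<omega> x = snd \<omega>1 x" if "x \<in> xverts V E - fwd \<omega>1" for x
    using that \<rho>(1) \<omega>(1) by (auto simp: swapped_fiber_iff \<omega>_def C_def)
  moreover have "fst \<omega> x = fst \<omega>2 x \<and> snd \<omega> x = snd \<omega>2 x" if "x \<in> xverts V E - fwd \<omega>2" for x
    using that \<rho>(2) \<omega>(2) by (auto simp: swapped_fiber_iff \<omega>_def C_def)
  ultimately show ?thesis
    using frozen_eqI(2)[of \<omega>1 \<omega>] frozen_eqI(2)[of \<omega>2 \<omega>] \<omega> by metis
qed

lemma fiber_eq:
  assumes "\<omega> \<in> good_pairs"
  shows "{\<omega>' \<in> good_pairs. frozen \<omega>' = frozen \<omega>} = fiber \<omega>"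
proof (intro set_eqI iffI)
  have \<omega>: "\<omega> \<in> pairs" using assms by (simp add: good_pairs_def)
  fix \<omega>'
  {
    assume "\<omega>' \<in> {\<omega>' \<in> good_pairs. frozen \<omega>' = frozen \<omega>}"
    then show "\<omega>' \<in> fiber \<omega>"
      using frozen_eqD(2)[of \<omega> \<omega>'] \<omega> by (auto simp: fiber_iff good_pairs_def)
  next
    assume "\<omega>' \<in> fiber \<omega>"
    then have \<omega>': "\<omega>' \<in> pairs" "\<And>x. x \<in> xverts V E - fwd \<omega> \<Longrightarrow> fst \<omega>' x = fst \<omega> x \<and> snd \<omega>' x = snd \<omega> x"
      using \<omega> by (auto simp: fiber_iff)
    note * = frozen_eqI[OF \<omega> \<omega>']
    have "\<S> \<omega> \<subseteq> xverts V E - fwd \<omega>" using separatingD[OF \<omega>] by blast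
    then have "fst \<omega>' (Mid e) = 0 \<and> snd \<omega>' (Mid e) = 0" if "Mid e \<in> \<S> \<omega>" for e
      using \<omega>'(2)[of "Mid e"] that assms by (auto simp: good_pairs_def)
    then show "\<omega>' \<in> {\<omega>' \<in> good_pairs. frozen \<omega>' = frozen \<omega>}"
      using * \<omega>' by (auto simp: good_pairs_def)
  }
qed

text \<open>Both the separating set and the disagreements on it are determined by the values off the
  forward set.\<close>

lemma cost_fiber:
  assumes "\<omega> \<in> pairs" "\<omega>' \<in> fiber \<omega>"
  shows "cost \<omega>' = cost \<omega>"
proof -
  have \<omega>': "\<omega>' \<in> pairs" "\<And>x. x \<in> xverts V E - fwd \<omega> \<Longrightarrow> fst \<omega>' x = fst \<omega> x \<and> snd \<omega>' x = snd \<omega> x"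
    using assms by (auto simp: fiber_iff)
  have "\<S> \<omega>' = \<S> \<omega>" by (rule frozen_eqI[OF assms(1) \<omega>'])
  moreover have "\<S> \<omega> \<subseteq> xverts V E - fwd \<omega>" using separatingD[OF assms(1)] by blast
  ultimately have "\<S> \<omega>' \<inter> disagreement V E \<omega>' = \<S> \<omega> \<inter> disagreement V E \<omega>"
    using \<omega>'(2) by (auto simp: disagreement_def)
  then show ?thesis by (simp add: cost_def)
qed

text \<open>\<open>sum_cylinder_swap\<close> is applied with the forward set as free region and the
  disagreements in the separating set as \<open>T\<close>. A non-forward site next to a forward one
  must lie in the separating set: as a vertex where the copies differ it belongs to
  \<open>T\<close>, as a midpoint it carries 0.\<close>

lemma fiber_weight_le:
  assumes b: "b > 0" and good: "\<omega> \<in> good_pairs"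
  shows "(\<Sum>\<omega>'\<in>fiber \<omega>. weight b (fst \<omega>') * weight b (snd \<omega>') * exp (- (4 * \<Delta> * J * b * cost \<omega>')))
    \<le> (\<Sum>\<rho>\<in>swapped_fiber \<omega>. weight b (fst \<rho>) * weight b (snd \<rho>))"
proof -
  have \<omega>: "\<omega> \<in> pairs" and zero: "\<And>e. Mid e \<in> \<S> \<omega> \<Longrightarrow> fst \<omega> (Mid e) = 0 \<and> snd \<omega> (Mid e) = 0"
    using good by (auto simp: good_pairs_def)
  let ?Y = "\<lambda>s \<tau>. sum (weight b) (cylinder V E B1 s (fwd \<omega>) \<tau>)"
  let ?T = "\<S> \<omega> \<inter> disagreement V E \<omega>"
  have in_V: "Vert v \<in> xverts V E" if "v \<in> V" for v using that by (simp add: xverts_def)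
  have edge: "v \<in> V" "Vert v \<in> xverts V E" "Mid e \<in> xverts V E" if "e \<in> E" "v \<in> e" for e v
    using that edge_subset by (auto simp: xverts_def)
  have "?Y 1 (fst \<omega>) * ?Y (-1) (snd \<omega>) \<le> exp (4 * J * b * \<Delta> * card ?T) * (?Y 1 (snd \<omega>) * ?Y (-1) (fst \<omega>))"
  proof (rule sum_cylinder_swap[OF b])
    show "fst \<omega> (Vert v) \<in> {-1, 1}" "snd \<omega> (Vert v) \<in> {-1, 1}" if "v \<in> V" for v
      using \<omega> in_V[OF that] unfolding pairs_iff by (metis spin_values_simps(1))+
    show "finite ?T" using finite_xverts by (auto simp: disagreement_def)
    fix e v assume e: "e \<in> E" "v \<in> e"
    show "Vert v \<in> ?T" if "Mid e \<in> fwd \<omega>" "Vert v \<notin> fwd \<omega>" "fst \<omega> (Vert v) \<noteq> snd \<omega> (Vert v)"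
      using forward_set_step[OF that(1), of "Vert v"] xadj_midpoint[OF e] edge[OF e] that
      by (auto simp: disagreement_def)
    show "fst \<omega> (Mid e) = 0 \<and> snd \<omega> (Mid e) = 0" if "Mid e \<notin> fwd \<omega>" "Vert v \<in> fwd \<omega>"
      using forward_set_step[OF that(2), of "Mid e"] xadj_midpoint[OF e] edge[OF e] that zero by blast
  qed (use degree in auto)
  then have "exp (- (4 * \<Delta> * J * b * cost \<omega>)) * (?Y 1 (fst \<omega>) * ?Y (-1) (snd \<omega>))
    \<le> exp (- (4 * \<Delta> * J * b * cost \<omega>)) * (exp (4 * J * b * \<Delta> * card ?T) * (?Y 1 (snd \<omega>) * ?Y (-1) (fst \<omega>)))"
    by (intro mult_left_mono) auto
  also have "\<dots> = ?Y 1 (snd \<omega>) * ?Y (-1) (fst \<omega>)"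
    unfolding mult.assoc[symmetric] exp_add[symmetric] by (simp add: cost_def mult_ac)
  also have "\<dots> = (\<Sum>\<rho>\<in>swapped_fiber \<omega>. weight b (fst \<rho>) * weight b (snd \<rho>))"
    by (simp add: swapped_fiber_def sum_product sum.cartesian_product case_prod_unfold)
  also have "exp (- (4 * \<Delta> * J * b * cost \<omega>)) * (?Y 1 (fst \<omega>) * ?Y (-1) (snd \<omega>))
    = (\<Sum>\<omega>'\<in>fiber \<omega>. weight b (fst \<omega>') * weight b (snd \<omega>') * exp (- (4 * \<Delta> * J * b * cost \<omega>)))"
    unfolding sum_distrib_right[symmetric]
    by (simp add: fiber_def sum_product sum.cartesian_product case_prod_unfold)
  also have "\<dots> = (\<Sum>\<omega>'\<in>fiber \<omega>. weight b (fst \<omega>') * weight b (snd \<omega>') * exp (- (4 * \<Delta> * J * b * cost \<omega>')))"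
    using cost_fiber[OF \<omega>] by (intro sum.cong) auto
  finally show ?thesis .
qed

text \<open>Good pairs split into the classes of \<open>frozen\<close>, each a fiber bounded by its
  swapped fiber. The swapped fibers of different classes are disjoint and all have mixed boundary
  conditions, so together they contribute at most the product of the mixed partition
  functions.\<close>

lemma sum_good_pairs_le:
  assumes b: "b > 0"
  shows "(\<Sum>\<omega>\<in>good_pairs. weight b (fst \<omega>) * weight b (snd \<omega>) * exp (- (4 * \<Delta> * J * b * cost \<omega>)))
    \<le> Z 1 (-1) b * Z (-1) 1 b"
proof -
  let ?g = "\<lambda>\<omega>. weight b (fst \<omega>) * weight b (snd \<omega>) * exp (- (4 * \<Delta> * J * b * cost \<omega>))"
  let ?f = "\<lambda>\<rho>. weight b (fst \<rho>) * weight b (snd \<rho>)"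
  have fin: "finite good_pairs"
    using finite_pairs by (simp add: good_pairs_def)
  define rep where "rep = inv_into good_pairs frozen"
  have rep: "rep k \<in> good_pairs" "frozen (rep k) = k" if "k \<in> frozen ` good_pairs" for k
    using that by (auto simp: rep_def inv_into_into f_inv_into_f)
  have rep': "rep k \<in> pairs" if "k \<in> frozen ` good_pairs" for k
    using rep[OF that] by (simp add: good_pairs_def)
  have "sum ?g good_pairs = (\<Sum>k\<in>frozen ` good_pairs. sum ?g {\<omega> \<in> good_pairs. frozen \<omega> = k})"
    by (rule sum.image_gen[OF fin])
  also have "\<dots> \<le> (\<Sum>k\<in>frozen ` good_pairs. sum ?f (swapped_fiber (rep k)))"
  proof (rule sum_mono)
    fix k assume k: "k \<in> frozen ` good_pairs"
    show "sum ?g {\<omega> \<in> good_pairs. frozen \<omega> = k} \<le> sum ?f (swapped_fiber (rep k))"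
      using fiber_eq[OF rep(1)[OF k]] fiber_weight_le[OF b rep(1)[OF k]] rep(2)[OF k] by simp
  qed
  also have "\<dots> = sum ?f (\<Union>k\<in>frozen ` good_pairs. swapped_fiber (rep k))"
  proof (rule sum.UNION_disjoint[symmetric])
    show "\<forall>k\<in>frozen ` good_pairs. finite (swapped_fiber (rep k))"
      by (simp add: swapped_fiber_def finite_cylinder)
    show "\<forall>k\<in>frozen ` good_pairs. \<forall>l\<in>frozen ` good_pairs. k \<noteq> l \<longrightarrow> swapped_fiber (rep k) \<inter> swapped_fiber (rep l) = {}"
      using swapped_fiber_disjoint rep(2) rep' by (metis disjoint_iff)
  qed (use fin in simp)
  also have "\<dots> \<le> sum ?f (pinned_configs V E B1 B2 1 (-1) \<times> pinned_configs V E B1 B2 (-1) 1)"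
  proof (rule sum_mono2)
    show "(\<Union>k\<in>frozen ` good_pairs. swapped_fiber (rep k))
      \<subseteq> pinned_configs V E B1 B2 1 (-1) \<times> pinned_configs V E B1 B2 (-1) 1"
      using swapped_fiber_iff[OF rep'] by blast
  qed (use finite_pinned weight_nonneg[OF b] in auto)
  also have "\<dots> = Z 1 (-1) b * Z (-1) 1 b"
    using boundary_subset disjoint
    by (simp add: b flip: sum_pinned_configs)
      (simp add: sum_product sum.cartesian_product case_prod_unfold)
  finally show ?thesis .
qed

end

section \<open>The zero-temperature limit\<close>

text \<open>For finite \<open>\<beta>\<close> the filter is principal at a point, so a limit along
  it is evaluation. One limit argument then serves both temperature regimes.\<close>

definition temp_filter :: "ereal \<Rightarrow> real filter" where
  "temp_filter \<beta> = (if \<beta> = \<infinity> then at_top else principal {real_of_ereal \<beta>})"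

lemma temp_filter_neq_bot: "temp_filter \<beta> \<noteq> bot"
  by (simp add: temp_filter_def principal_eq_bot_iff)

lemma eventually_temp_filter_pos:
  assumes "\<beta> > 0"
  shows "\<forall>\<^sub>F b in temp_filter \<beta>. b > 0"
  using assms by (cases \<beta>) (auto simp: temp_filter_def eventually_gt_at_top eventually_principal)

lemma tendsto_at_temp:
  assumes "(f \<longlongrightarrow> l) at_top"
  shows "(f \<longlongrightarrow> at_temp \<beta> f) (temp_filter \<beta>)"
  using assms tendsto_Lim[OF _ assms]
  by (simp add: temp_filter_def at_temp_def tendsto_principal_singleton)

text \<open>A sum of exponentials lies between its largest term and \<open>card I\<close> times that
  term; after taking logarithms and dividing by \<open>b\<close>, the gap
  \<open>ln (card I) / b\<close> vanishes.\<close>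

lemma tendsto_ln_sum_exp:
  fixes a :: "'i \<Rightarrow> real"
  assumes "finite I" "I \<noteq> {}"
  shows "((\<lambda>b. 1 / b * ln (\<Sum>i\<in>I. exp (b * a i))) \<longlongrightarrow> Max (a ` I)) at_top"
proof (rule tendsto_sandwich)
  let ?M = "Max (a ` I)"
  have pos: "(\<Sum>i\<in>I. exp (b * a i)) > 0" for b
    using assms by (intro sum_pos) auto
  have lower: "?M \<le> 1 / b * ln (\<Sum>i\<in>I. exp (b * a i))" if "b > 0" for b
  proof -
    obtain i where "i \<in> I" "a i = ?M"
      using Max_in[of "a ` I"] assms by fastforce
    then have "exp (b * ?M) \<le> (\<Sum>i\<in>I. exp (b * a i))"
      using member_le_sum[of i I "\<lambda>i. exp (b * a i)"] assms by simp
    then have "b * ?M \<le> ln (\<Sum>i\<in>I. exp (b * a i))"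
      using pos by (simp add: ln_ge_iff)
    then show ?thesis using that by (simp add: field_simps)
  qed
  have upper: "1 / b * ln (\<Sum>i\<in>I. exp (b * a i)) \<le> ?M + 1 / b * ln (card I)" if "b > 0" for b
  proof -
    have "(\<Sum>i\<in>I. exp (b * a i)) \<le> (\<Sum>i\<in>I. exp (b * ?M))"
      using assms that by (intro sum_mono) auto
    then have "(\<Sum>i\<in>I. exp (b * a i)) \<le> card I * exp (b * ?M)" by simp
    then have "ln (\<Sum>i\<in>I. exp (b * a i)) \<le> ln (card I * exp (b * ?M))"
      using pos[of b] assms by (subst ln_le_cancel_iff) (auto simp: card_gt_0_iff)
    also have "\<dots> = ln (card I) + b * ?M"
      using assms by (simp add: ln_mult card_gt_0_iff)
    finally show ?thesis using that by (simp add: field_simps)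
  qed
  show "\<forall>\<^sub>F b in at_top. ?M \<le> 1 / b * ln (\<Sum>i\<in>I. exp (b * a i))"
    using eventually_gt_at_top[of 0] by eventually_elim (rule lower)
  show "\<forall>\<^sub>F b in at_top. 1 / b * ln (\<Sum>i\<in>I. exp (b * a i)) \<le> ?M + 1 / b * ln (card I)"
    using eventually_gt_at_top[of 0] by eventually_elim (rule upper)
  have "((\<lambda>b. 1 / b) \<longlongrightarrow> (0::real)) at_top"
    using tendsto_inverse_0_at_top[OF filterlim_ident] by (simp add: inverse_eq_divide)
  then show "((\<lambda>b. ?M + 1 / b * ln (card I)) \<longlongrightarrow> ?M) at_top"
    using tendsto_add[OF tendsto_const[of ?M] tendsto_mult_left_zero] by fastforce
qed simp

text \<open>Pure exponential growth rate: enough to make ratios of such functions converge at infinity.\<close>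

definition exp_growth :: "(real \<Rightarrow> real) \<Rightarrow> bool" where
  "exp_growth f \<longleftrightarrow> (\<exists>a c. ((\<lambda>b. f b * exp (- (a * b))) \<longlongrightarrow> c) at_top
     \<and> (c = 0 \<longrightarrow> (\<forall>\<^sub>F b in at_top. f b = 0)))"

text \<open>Rates add and leading constants multiply; if the product of the constants is 0, one
  factor vanishes eventually.\<close>

lemma exp_growth_mult:
  assumes "exp_growth f" "exp_growth g"
  shows "exp_growth (\<lambda>b. f b * g b)"
proof -
  obtain a c where f: "((\<lambda>b. f b * exp (- (a * b))) \<longlongrightarrow> c) at_top"
      "c = 0 \<longrightarrow> (\<forall>\<^sub>F b in at_top. f b = 0)"
    using assms(1) unfolding exp_growth_def by blast
  obtain a' c' where g: "((\<lambda>b. g b * exp (- (a' * b))) \<longlongrightarrow> c') at_top"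
      "c' = 0 \<longrightarrow> (\<forall>\<^sub>F b in at_top. g b = 0)"
    using assms(2) unfolding exp_growth_def by blast
  have "exp (- ((a + a') * b)) = exp (- (a * b)) * exp (- (a' * b))" for b
    by (simp add: algebra_simps flip: exp_add)
  then have "(\<lambda>b. f b * g b * exp (- ((a + a') * b))) = (\<lambda>b. f b * exp (- (a * b)) * (g b * exp (- (a' * b))))"
    by (simp add: mult_ac)
  then have "((\<lambda>b. f b * g b * exp (- ((a + a') * b))) \<longlongrightarrow> c * c') at_top"
    using tendsto_mult[OF f(1) g(1)] by simp
  moreover have "\<forall>\<^sub>F b in at_top. f b * g b = 0" if "c * c' = 0"
    using that f(2) g(2) by (auto elim: eventually_mono)
  ultimately show ?thesis unfolding exp_growth_def by blast
qed

lemma exp_growth_exp: "exp_growth (\<lambda>b. exp (a * b))"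
  unfolding exp_growth_def by (intro exI[of _ a] exI[of _ 1]) (simp flip: exp_add)

lemma exp_growth_zero: "exp_growth (\<lambda>b. 0)"
  unfolding exp_growth_def by auto

lemma exp_growth_prod:
  assumes "\<And>i. i \<in> I \<Longrightarrow> exp_growth (f i)"
  shows "exp_growth (\<lambda>b. \<Prod>i\<in>I. f i b)"
  \<comment> \<open>Rate 0 covers the constant 1, the value of the product over the empty set and,
    by convention, over an infinite one.\<close>
  using assms exp_growth_exp[of 0]
  by (induction I rule: infinite_finite_induct) (auto intro: exp_growth_mult)

lemma exp_growth_cong:
  assumes "exp_growth f" "\<forall>\<^sub>F b in at_top. g b = f b"
  shows "exp_growth g"
proof -
  obtain a c where f: "((\<lambda>b. f b * exp (- (a * b))) \<longlongrightarrow> c) at_top"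
      "c = 0 \<Longrightarrow> \<forall>\<^sub>F b in at_top. f b = 0"
    using assms(1) unfolding exp_growth_def by blast
  have "((\<lambda>b. g b * exp (- (a * b))) \<longlongrightarrow> c) at_top"
    using assms(2) by (intro Lim_transform_eventually[OF f(1)]) (auto elim: eventually_mono)
  moreover have "\<forall>\<^sub>F b in at_top. g b = 0" if "c = 0"
    using f(2)[OF that] assms(2) by eventually_elim simp
  ultimately show ?thesis unfolding exp_growth_def by blast
qed

text \<open>All terms are compared at the largest rate \<open>M\<close>: those of smaller rate
  vanish after scaling, and those of rate \<open>M\<close> converge to their leading constants.
  Nonnegativity excludes cancellation in the denominator, and the positive term \<open>k\<close>
  guarantees that some leading constant is nonzero.\<close>

lemma exp_growth_ratio_converges:
  fixes f :: "'i \<Rightarrow> real \<Rightarrow> real"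
  assumes "finite I" and growth: "\<And>i. i \<in> I \<Longrightarrow> exp_growth (f i)"
    and nonneg: "\<And>i b. i \<in> I \<Longrightarrow> b > 0 \<Longrightarrow> f i b \<ge> 0"
    and pos: "k \<in> I" "\<And>b. b > 0 \<Longrightarrow> f k b > 0" and "j \<in> I"
  shows "\<exists>l. ((\<lambda>b. f j b / (\<Sum>i\<in>I. f i b)) \<longlongrightarrow> l) at_top"
proof -
  obtain a c where lim: "\<And>i. i \<in> I \<Longrightarrow> ((\<lambda>b. f i b * exp (- (a i * b))) \<longlongrightarrow> c i) at_top"
      and zero: "\<And>i. i \<in> I \<Longrightarrow> c i = 0 \<Longrightarrow> \<forall>\<^sub>F b in at_top. f i b = 0"
    using growth unfolding exp_growth_def by metis
  \<comment> \<open>A vanishing constant means that the term is eventually 0, so its rate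
    \<open>a i\<close> carries no information and must not enter the maximum.\<close>
  define I' where "I' = {i \<in> I. c i \<noteq> 0}"
  have "k \<in> I'"
  proof (rule ccontr)
    assume "k \<notin> I'"
    then have "\<forall>\<^sub>F b in at_top. f k b = 0" using zero pos(1) by (auto simp: I'_def)
    then have "\<forall>\<^sub>F b :: real in at_top. False"
      using eventually_gt_at_top[of 0] by eventually_elim (use pos(2) in force)
    then show False by simp
  qed
  define M where "M = Max (a ` I')"
  have fin: "finite I'" using assms(1) by (simp add: I'_def)
  define d where "d i = (if i \<in> I' \<and> a i = M then c i else 0)" for i
  have d: "((\<lambda>b. f i b * exp (- (M * b))) \<longlongrightarrow> d i) at_top" if i: "i \<in> I" for i
  proof (cases "i \<in> I'")
    case False
    then have "\<forall>\<^sub>F b in at_top. f i b = 0" using zero i by (auto simp: I'_def)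
    then have "\<forall>\<^sub>F b in at_top. 0 = f i b * exp (- (M * b))" by eventually_elim simp
    then show ?thesis
      using False by (auto simp: d_def intro: Lim_transform_eventually[OF tendsto_const])
  next
    case True
    show ?thesis
    proof (cases "a i = M")
      case eq: True
      then show ?thesis using lim[OF i] True by (simp add: d_def)
    next
      case False
      then have less: "a i < M" using True fin by (simp add: M_def order_less_le)
      have "filterlim (\<lambda>b. (M - a i) * b) at_top at_top"
        using less by (intro filterlim_tendsto_pos_mult_at_top[OF tendsto_const] filterlim_ident) auto
      then have "((\<lambda>b. exp (- ((M - a i) * b))) \<longlongrightarrow> 0) at_top"
        by (intro filterlim_compose[OF exp_at_bot]) (simp add: filterlim_uminus_at_bot)
      from tendsto_mult[OF lim[OF i] this]
      have "((\<lambda>b. f i b * exp (- (a i * b)) * exp (- ((M - a i) * b))) \<longlongrightarrow> 0) at_top" by simp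
      also have "(\<lambda>b. f i b * exp (- (a i * b)) * exp (- ((M - a i) * b))) = (\<lambda>b. f i b * exp (- (M * b)))"
        by (simp add: algebra_simps mult.assoc flip: exp_add)
      finally show ?thesis using False by (simp add: d_def)
    qed
  qed
  have d_nonneg: "d i \<ge> 0" if "i \<in> I" for i
    using d[OF that]
  proof (rule tendsto_lowerbound)
    show "\<forall>\<^sub>F b in at_top. 0 \<le> f i b * exp (- (M * b))"
      using eventually_gt_at_top[of 0] by eventually_elim (use nonneg that in auto)
  qed simp
  obtain m where m: "m \<in> I'" "a m = M"
    using Max_in[of "a ` I'"] fin \<open>k \<in> I'\<close> unfolding M_def by fastforce
  then have "d m > 0"
    using d_nonneg[of m] by (auto simp: d_def I'_def)
  then have d_pos: "sum d I > 0"
    using m assms(1) d_nonneg by (intro sum_pos2[of I m]) (auto simp: I'_def)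
  have "((\<lambda>b. (f j b * exp (- (M * b))) / (\<Sum>i\<in>I. f i b * exp (- (M * b)))) \<longlongrightarrow> d j / sum d I) at_top"
    using d_pos by (intro tendsto_intros d assms) auto
  also have "(\<lambda>b. (f j b * exp (- (M * b))) / (\<Sum>i\<in>I. f i b * exp (- (M * b)))) = (\<lambda>b. f j b / (\<Sum>i\<in>I. f i b))"
    by (simp flip: sum_distrib_right)
  finally show ?thesis by blast
qed

text \<open>With \<open>y = 0\<close> the rate is \<open>- J / 2\<close>. Otherwise, for positive
  \<open>b\<close>, the weight is 0 or \<open>sqrt (2 * sinh (J * b))\<close>, the latter of rate
  \<open>J / 2\<close> and leading constant 1.\<close>

lemma exp_growth_xW:
  assumes "J > 0" "x \<noteq> 0"
  shows "exp_growth (\<lambda>b. xW J b x y)"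
proof (cases "y = 0")
  case True
  have "\<forall>\<^sub>F b in at_top. xW J b x y = exp (- J / 2 * b)"
    using eventually_gt_at_top[of 0] by eventually_elim (use True assms in \<open>simp add: xW_zero\<close>)
  then show ?thesis by (rule exp_growth_cong[OF exp_growth_exp])
next
  case False
  have "exp_growth (\<lambda>b. sqrt (2 * sinh (J * b)))"
    unfolding exp_growth_def
  proof (intro exI conjI impI)
    have "filterlim (\<lambda>b. 2 * J * b) at_top at_top"
      using assms by (intro filterlim_tendsto_pos_mult_at_top[OF tendsto_const] filterlim_ident) auto
    then have "((\<lambda>b. exp (- (2 * J * b))) \<longlongrightarrow> 0) at_top"
      by (intro filterlim_compose[OF exp_at_bot]) (simp add: filterlim_uminus_at_bot)
    then have "((\<lambda>b. sqrt (1 - exp (- (2 * J * b)))) \<longlongrightarrow> 1) at_top"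
      using tendsto_real_sqrt[OF tendsto_diff[OF tendsto_const[of 1]]] by fastforce
    also have "(\<lambda>b. sqrt (1 - exp (- (2 * J * b)))) = (\<lambda>b. sqrt (2 * sinh (J * b)) * exp (- (J / 2 * b)))"
    proof
      fix b
      have "exp (- (J / 2 * b)) = sqrt (exp (- (J * b)))"
        by (rule real_sqrt_unique[symmetric]) (simp_all add: power2_eq_square flip: exp_add)
      moreover have "2 * sinh (J * b) * exp (- (J * b)) = 1 - exp (- (2 * J * b))"
        by (simp add: sinh_def algebra_simps flip: exp_add)
      ultimately show "sqrt (1 - exp (- (2 * J * b))) = sqrt (2 * sinh (J * b)) * exp (- (J / 2 * b))"
        by (metis real_sqrt_mult)
    qed
    finally show "((\<lambda>b. sqrt (2 * sinh (J * b)) * exp (- (J / 2 * b))) \<longlongrightarrow> 1) at_top" .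
  qed simp
  then have *: "exp_growth (\<lambda>b. of_bool (x = y) * sqrt (2 * sinh (J * b)))"
    using exp_growth_zero by (cases "x = y") auto
  have "\<forall>\<^sub>F b in at_top. xW J b x y = of_bool (x = y) * sqrt (2 * sinh (J * b))"
    using eventually_gt_at_top[of 0] by eventually_elim (use False assms in \<open>simp add: xW_diag\<close>)
  then show ?thesis by (rule exp_growth_cong[OF *])
qed

section \<open>Existence of the limiting measures and surface tension\<close>

context ising_graph
begin

abbreviation "prob b A s \<tau> \<equiv> weight b \<tau> / (\<Sum>\<rho>\<in>xconfigs V E A s. weight b \<rho>)"

lemma finite_xconfigs: "finite (xconfigs V E A s)"
proof (rule finite_subset)
  show "xconfigs V E A s \<subseteq> PiE (xverts V E) spin_values"
    unfolding xconfigs_def spin_values_def by auto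
  show "finite (PiE (xverts V E) spin_values)"
    using finite_xverts by (intro finite_PiE) auto
qed

lemma xconfigs_spin: "\<tau> \<in> xconfigs V E A s \<Longrightarrow> v \<in> V \<Longrightarrow> \<tau> (Vert v) \<in> {-1, 1}"
  unfolding xconfigs_def by (force simp: xverts_def PiE_iff)

lemma exp_growth_weight:
  assumes "\<tau> \<in> xconfigs V E A s"
  shows "exp_growth (\<lambda>b. weight b \<tau>)"
proof -
  have "\<tau> (Vert v) \<noteq> 0" if "e \<in> E" "v \<in> e" for e v
    using xconfigs_spin[OF assms, of v] edge_subset[OF that(1)] that(2) by auto
  then show ?thesis
    unfolding xweight_def mult.commute[of _ "sum _ V"]
    by (intro exp_growth_mult exp_growth_prod exp_growth_xW exp_growth_exp J_pos) auto
qed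

text \<open>With 0 on all midpoints and \<open>s\<close> on all vertices each factor is strictly
  positive, whereas a nonzero midpoint that differs from an adjacent spin makes the weight
  vanish.\<close>

lemma xconfigs_positive:
  assumes "A \<subseteq> V" "s \<in> {-1, 1}"
  obtains \<tau> where "\<tau> \<in> xconfigs V E A s" "\<And>b. b > 0 \<Longrightarrow> weight b \<tau> > 0"
proof
  let ?\<tau> = "restrict (case_xvert (\<lambda>v. s) (\<lambda>e. 0)) (xverts V E)"
  show "?\<tau> \<in> xconfigs V E A s"
    using assms by (auto simp: xconfigs_def xverts_def split: xvert.split)
  have "v \<in> V" if "e \<in> E" "v \<in> e" for e v
    using edge_subset that by blast
  then show "weight b ?\<tau> > 0" if "b > 0" for b
    using assms J_pos that by (auto simp: xweight_def xverts_def xW_zero intro!: mult_pos_pos prod_pos)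
qed

lemma sum_xconfigs_pos:
  assumes "A \<subseteq> V" "s \<in> {-1, 1}" "b > 0"
  shows "(\<Sum>\<rho>\<in>xconfigs V E A s. weight b \<rho>) > 0"
proof -
  obtain \<tau> where "\<tau> \<in> xconfigs V E A s" "weight b \<tau> > 0"
    using xconfigs_positive[OF assms(1,2)] assms(3) by blast
  then show ?thesis
    using weight_nonneg[OF assms(3)] by (intro sum_pos2[OF finite_xconfigs]) auto
qed

text \<open>The weights have exponential growth rates and one of them is positive, so the pointwise
  limit in the definition of the zero-temperature measure exists.\<close>

lemma tendsto_prob:
  assumes "A \<subseteq> V" "s \<in> {-1, 1}" "\<tau> \<in> xconfigs V E A s"
  shows "((\<lambda>b. prob b A s \<tau>) \<longlongrightarrow> at_temp \<beta> (\<lambda>b. prob b A s \<tau>)) (temp_filter \<beta>)"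
proof -
  obtain \<tau>0 where \<tau>0: "\<tau>0 \<in> xconfigs V E A s" "\<And>b. b > 0 \<Longrightarrow> weight b \<tau>0 > 0"
    using xconfigs_positive[OF assms(1,2)] by blast
  have "\<exists>l. ((\<lambda>b. prob b A s \<tau>) \<longlongrightarrow> l) at_top"
    by (rule exp_growth_ratio_converges[where f = "\<lambda>\<tau> b. weight b \<tau>", OF finite_xconfigs _ _ \<tau>0 assms(3)])
      (use exp_growth_weight weight_nonneg in auto)
  then show ?thesis using tendsto_at_temp by blast
qed

text \<open>\<open>embed_pmf\<close> is meaningful only for nonnegative masses of total 1. Both
  properties hold at positive \<open>b\<close> and pass to the limit, the sum being finite.\<close>

lemma pmf_xprob:
  assumes "A \<subseteq> V" "s \<in> {-1, 1}" "\<beta> > 0"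
  shows "pmf (xprob V E J h \<epsilon> \<eta> \<beta> A s) \<tau>
    = (if \<tau> \<in> xconfigs V E A s then at_temp \<beta> (\<lambda>b. prob b A s \<tau>) else 0)"
  unfolding xprob_def
proof (rule pmf_embed_pmf)
  let ?X = "xconfigs V E A s"
  let ?p = "\<lambda>\<tau>. at_temp \<beta> (\<lambda>b. prob b A s \<tau>)"
  note pos = eventually_temp_filter_pos[OF assms(3)]
  have nonneg: "?p \<tau> \<ge> 0" if "\<tau> \<in> ?X" for \<tau>
    using tendsto_prob[OF assms(1,2) that]
  proof (rule tendsto_lowerbound)
    show "\<forall>\<^sub>F b in temp_filter \<beta>. 0 \<le> prob b A s \<tau>"
      using pos by eventually_elim (auto intro!: divide_nonneg_nonneg sum_nonneg weight_nonneg)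
  qed (rule temp_filter_neq_bot)
  then show "0 \<le> (if \<tau> \<in> ?X then ?p \<tau> else 0)" for \<tau> by simp
  have "((\<lambda>b. \<Sum>\<tau>\<in>?X. prob b A s \<tau>) \<longlongrightarrow> (\<Sum>\<tau>\<in>?X. ?p \<tau>)) (temp_filter \<beta>)"
    by (intro tendsto_sum tendsto_prob assms(1,2))
  moreover have "\<forall>\<^sub>F b in temp_filter \<beta>. (\<Sum>\<tau>\<in>?X. prob b A s \<tau>) = 1"
    using pos
  proof eventually_elim
    case (elim b)
    show ?case using sum_xconfigs_pos[OF assms(1,2) elim] by (simp flip: sum_divide_distrib)
  qed
  ultimately have "((\<lambda>b. 1) \<longlongrightarrow> (\<Sum>\<tau>\<in>?X. ?p \<tau>)) (temp_filter \<beta>)"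
    by (rule Lim_transform_eventually)
  then have sum: "(\<Sum>\<tau>\<in>?X. ?p \<tau>) = 1"
    using tendsto_unique[OF temp_filter_neq_bot] tendsto_const by blast
  have "(\<integral>\<^sup>+\<tau>. ennreal (if \<tau> \<in> ?X then ?p \<tau> else 0) \<partial>count_space UNIV)
    = (\<Sum>\<tau>\<in>?X. ennreal (if \<tau> \<in> ?X then ?p \<tau> else 0))"
    using finite_xconfigs by (intro nn_integral_count_space') auto
  also have "\<dots> = ennreal (\<Sum>\<tau>\<in>?X. ?p \<tau>)"
    using nonneg by (subst sum_ennreal[symmetric]) auto
  finally show "(\<integral>\<^sup>+\<tau>. ennreal (if \<tau> \<in> ?X then ?p \<tau> else 0) \<partial>count_space UNIV) = 1"
    using sum by simp
qed

lemma ising_Z_exp: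
  "ising_Z V E J h \<epsilon> \<eta> B1 B2 s1 s2 b =
    (\<Sum>\<sigma> | \<sigma> \<in> (V \<rightarrow>\<^sub>E {-1, 1}) \<and> (\<forall>v\<in>B1. \<sigma> v = s1) \<and> (\<forall>v\<in>B2. \<sigma> v = s2).
      exp (b * - ising_energy V E J h \<epsilon> \<eta> \<sigma>))"
  by (simp add: ising_Z_def)

lemma ising_configs:
  fixes s1 s2 :: real
  assumes "B1 \<subseteq> V" "B2 \<subseteq> V" "B1 \<inter> B2 = {}" "s1 \<in> {-1, 1}" "s2 \<in> {-1, 1}"
  shows "finite {\<sigma> \<in> V \<rightarrow>\<^sub>E {-1, 1}. (\<forall>v\<in>B1. \<sigma> v = s1) \<and> (\<forall>v\<in>B2. \<sigma> v = s2)}"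
    "{\<sigma> \<in> V \<rightarrow>\<^sub>E {-1, 1}. (\<forall>v\<in>B1. \<sigma> v = s1) \<and> (\<forall>v\<in>B2. \<sigma> v = s2)} \<noteq> {}"
proof -
  show "finite {\<sigma> \<in> V \<rightarrow>\<^sub>E {-1, 1}. (\<forall>v\<in>B1. \<sigma> v = s1) \<and> (\<forall>v\<in>B2. \<sigma> v = s2)}"
    using finite_V by (intro finite_Collect_conjI disjI1) (simp add: finite_PiE)
  have "restrict (\<lambda>v. if v \<in> B1 then s1 else s2) V
      \<in> {\<sigma> \<in> V \<rightarrow>\<^sub>E {-1, 1}. (\<forall>v\<in>B1. \<sigma> v = s1) \<and> (\<forall>v\<in>B2. \<sigma> v = s2)}"
    using assms by auto
  then show "{\<sigma> \<in> V \<rightarrow>\<^sub>E {-1, 1}. (\<forall>v\<in>B1. \<sigma> v = s1) \<and> (\<forall>v\<in>B2. \<sigma> v = s2)} \<noteq> {}"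
    by blast
qed

lemma ising_Z_pos:
  assumes "B1 \<subseteq> V" "B2 \<subseteq> V" "B1 \<inter> B2 = {}" "s1 \<in> {-1, 1}" "s2 \<in> {-1, 1}"
  shows "ising_Z V E J h \<epsilon> \<eta> B1 B2 s1 s2 b > 0"
  unfolding ising_Z_exp by (intro sum_pos ising_configs[OF assms]) auto

text \<open>The logarithm of the ratio splits into four terms \<open>ln Z / b\<close>, each of which
  converges as a scaled logarithm of a sum of exponentials.\<close>

lemma tendsto_surface_tension:
  assumes "vbd F \<Lambda>1 \<subseteq> V" "vbd F \<Lambda>2 \<subseteq> V" "vbd F \<Lambda>1 \<inter> vbd F \<Lambda>2 = {}"
  defines "Z \<equiv> ising_Z V E J h \<epsilon> \<eta> (vbd F \<Lambda>1) (vbd F \<Lambda>2)"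
  shows "((\<lambda>b. 1 / b * ln ((Z 1 1 b * Z (-1) (-1) b) / (Z 1 (-1) b * Z (-1) 1 b)))
    \<longlongrightarrow> surface_tension F V E J h \<epsilon> \<eta> \<Lambda>1 \<Lambda>2 \<beta>) (temp_filter \<beta>)"
proof -
  have pos: "Z s1 s2 b > 0" if "s1 \<in> {-1, 1}" "s2 \<in> {-1, 1}" for s1 s2 b
    unfolding Z_def by (rule ising_Z_pos[OF assms(1-3) that])
  have nonzero: "Z 1 1 b \<noteq> 0" "Z (-1) (-1) b \<noteq> 0" "Z 1 (-1) b \<noteq> 0" "Z (-1) 1 b \<noteq> 0" for b
    using pos[of 1 1 b] pos[of "-1" "-1" b] pos[of 1 "-1" b] pos[of "-1" 1 b] by auto
  have "\<exists>l. ((\<lambda>b. 1 / b * ln (Z s1 s2 b)) \<longlongrightarrow> l) at_top" if "s1 \<in> {-1, 1}" "s2 \<in> {-1, 1}" for s1 s2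
    unfolding Z_def ising_Z_exp by (rule exI, rule tendsto_ln_sum_exp[OF ising_configs[OF assms(1-3) that]])
  then obtain l where l: "((\<lambda>b. 1 / b * ln (Z s1 s2 b)) \<longlongrightarrow> l s1 s2) at_top"
      if "s1 \<in> {-1, 1}" "s2 \<in> {-1, 1}" for s1 s2
    by metis
  have "(\<lambda>b. 1 / b * ln ((Z 1 1 b * Z (-1) (-1) b) / (Z 1 (-1) b * Z (-1) 1 b)))
    = (\<lambda>b. 1 / b * ln (Z 1 1 b) + 1 / b * ln (Z (-1) (-1) b) - (1 / b * ln (Z 1 (-1) b) + 1 / b * ln (Z (-1) 1 b)))"
    by (rule ext) (simp add: nonzero ln_div ln_mult add_divide_distrib diff_divide_distrib)
  moreover have "((\<lambda>b. 1 / b * ln (Z 1 1 b) + 1 / b * ln (Z (-1) (-1) b) - (1 / b * ln (Z 1 (-1) b) + 1 / b * ln (Z (-1) 1 b)))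
    \<longlongrightarrow> l 1 1 + l (-1) (-1) - (l 1 (-1) + l (-1) 1)) at_top"
    by (intro tendsto_intros l) auto
  ultimately show ?thesis
    unfolding surface_tension_def Let_def Z_def[symmetric] by (intro tendsto_at_temp) simp
qed

end

section \<open>Jensen's inequality\<close>

context separated_pair
begin

abbreviation "A \<equiv> B2 \<union> B1"

definition pair_prob :: "real \<Rightarrow> ('a xvert \<Rightarrow> real) \<times> ('a xvert \<Rightarrow> real) \<Rightarrow> real" where
  "pair_prob b \<omega> = prob b A 1 (fst \<omega>) * prob b A (-1) (snd \<omega>)"

definition tension :: "real \<Rightarrow> real" where
  "tension b = 1 / b * ln ((Z 1 1 b * Z (-1) (-1) b) / (Z 1 (-1) b * Z (-1) 1 b))"

lemma A_subset: "A \<subseteq> V"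
  using boundary_subset by blast

lemma sum_xconfigs_eq_Z:
  assumes "b > 0" "s \<in> {-1, 1}"
  shows "(\<Sum>\<rho>\<in>xconfigs V E A s. weight b \<rho>) = Z s s b"
proof -
  have "xconfigs V E A s = pinned_configs V E B1 B2 s s"
    using A_subset assms by (intro xconfigs_alt) auto
  then show ?thesis
    using sum_pinned_configs[OF assms(1) boundary_subset disjoint assms(2) assms(2)] by simp
qed

lemma Z_pos: "s1 \<in> {-1, 1} \<Longrightarrow> s2 \<in> {-1, 1} \<Longrightarrow> Z s1 s2 b > 0"
  by (rule ising_Z_pos[OF boundary_subset disjoint])

lemma pair_prob_nonneg: "b > 0 \<Longrightarrow> pair_prob b \<omega> \<ge> 0"
  unfolding pair_prob_def
  by (intro mult_nonneg_nonneg divide_nonneg_nonneg sum_nonneg weight_nonneg)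

text \<open>The bound on the weights is divided by the normalising constants; the ratio of partition
  functions that remains is the exponential of \<open>- b\<close> times the tension at
  \<open>b\<close>.\<close>

lemma sum_pair_prob_exp_le:
  assumes b: "b > 0"
  shows "(\<Sum>\<omega>\<in>good_pairs. pair_prob b \<omega> * exp (- (4 * \<Delta> * J * b * cost \<omega>))) \<le> exp (- (b * tension b))"
proof -
  have Z: "Z 1 1 b > 0" "Z (-1) (-1) b > 0" "Z 1 (-1) b > 0" "Z (-1) 1 b > 0"
    by (intro Z_pos; simp)+
  have "(\<Sum>\<omega>\<in>good_pairs. pair_prob b \<omega> * exp (- (4 * \<Delta> * J * b * cost \<omega>)))
    = (\<Sum>\<omega>\<in>good_pairs. weight b (fst \<omega>) * weight b (snd \<omega>) * exp (- (4 * \<Delta> * J * b * cost \<omega>)))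
      / (Z 1 1 b * Z (-1) (-1) b)"
    by (simp add: pair_prob_def sum_xconfigs_eq_Z b sum_divide_distrib)
  also have "\<dots> \<le> (Z 1 (-1) b * Z (-1) 1 b) / (Z 1 1 b * Z (-1) (-1) b)"
    using sum_good_pairs_le[OF b] Z by (intro divide_right_mono) auto
  also have "\<dots> = inverse ((Z 1 1 b * Z (-1) (-1) b) / (Z 1 (-1) b * Z (-1) 1 b))"
    by simp
  also have "\<dots> = exp (- (b * tension b))"
    using Z b by (simp add: tension_def exp_minus)
  finally show ?thesis .
qed

text \<open>Jensen's inequality, from the tangent line of \<open>exp\<close> at the conditional mean.\<close>

lemma tension_le:
  defines "P \<equiv> \<lambda>b. \<Sum>\<omega>\<in>good_pairs. pair_prob b \<omega>"
    and "N \<equiv> \<lambda>b. \<Sum>\<omega>\<in>good_pairs. pair_prob b \<omega> * cost \<omega>"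
  assumes b: "b > 0" and P: "P b > 0"
  shows "tension b \<le> 4 * \<Delta> * J * (N b / P b) - 1 / b * ln (P b)"
proof -
  define c where "c = 4 * \<Delta> * J * b"
  \<comment> \<open>\<open>N b / P b\<close> is the mean of \<open>cost\<close> conditioned on
    \<open>good_pairs\<close>, so \<open>m\<close> is the conditional mean of
    \<open>c * cost\<close>.\<close>
  define m where "m = c * (N b / P b)"
  have "(\<Sum>\<omega>\<in>good_pairs. pair_prob b \<omega> * (exp (- m) * (1 + m - c * cost \<omega>)))
    \<le> (\<Sum>\<omega>\<in>good_pairs. pair_prob b \<omega> * exp (- (c * cost \<omega>)))"
  proof (intro sum_mono mult_left_mono pair_prob_nonneg b)
    fix \<omega>
    have "exp (- m) * (1 + (m - c * cost \<omega>)) \<le> exp (- m) * exp (m - c * cost \<omega>)"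
      by (intro mult_left_mono exp_ge_add_one_self) auto
    then show "exp (- m) * (1 + m - c * cost \<omega>) \<le> exp (- (c * cost \<omega>))"
      by (simp add: add_diff_eq flip: exp_add)
  qed
  also have "\<dots> \<le> exp (- (b * tension b))"
    using sum_pair_prob_exp_le[OF b] by (simp add: c_def)
  also have "(\<Sum>\<omega>\<in>good_pairs. pair_prob b \<omega> * (exp (- m) * (1 + m - c * cost \<omega>)))
    = exp (- m) * ((1 + m) * P b - c * N b)"
    by (simp add: P_def N_def sum_distrib_left sum_subtractf algebra_simps sum.distrib)
  \<comment> \<open>By the choice of \<open>m\<close> the linear term of the tangent has mean
    zero.\<close>
  also have "(1 + m) * P b - c * N b = P b"
    using P by (simp add: m_def field_simps)
  finally have "ln (exp (- m) * P b) \<le> ln (exp (- (b * tension b)))"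
    using P by (subst ln_le_cancel_iff) auto
  then have "b * tension b \<le> m - ln (P b)"
    using P by (simp add: ln_mult)
  then have "tension b \<le> (m - ln (P b)) / b"
    using b by (simp add: field_simps)
  also have "\<dots> = 4 * \<Delta> * J * (N b / P b) - 1 / b * ln (P b)"
    using b by (simp add: m_def c_def diff_divide_distrib)
  finally show ?thesis .
qed

text \<open>Under the measure at \<open>\<beta>\<close> the good pairs have full mass, so along
  \<open>temp_filter \<beta>\<close> the sums \<open>P\<close> tend to 1 and the correction
  \<open>ln P / b\<close> vanishes, while \<open>N\<close> tends to the expected cost. The bound at
  positive \<open>b\<close> then passes to the limit.\<close>

lemma surface_tension_le:
  assumes \<beta>: "\<beta> > 0"
    and zero: "AE \<omega> in measure_pmf (xpair V E J h \<epsilon> \<eta> \<beta> A).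
         \<forall>e. Mid e \<in> \<S> \<omega> \<longrightarrow> fst \<omega> (Mid e) = 0 \<and> snd \<omega> (Mid e) = 0"
  shows "surface_tension F V E J h \<epsilon> \<eta> \<Lambda>1 \<Lambda>2 \<beta>
    \<le> 4 * \<Delta> * J * measure_pmf.expectation (xpair V E J h \<epsilon> \<eta> \<beta> A)
          (\<lambda>\<omega>. real (card (\<S> \<omega> \<inter> disagreement V E \<omega>)))"
proof -
  let ?q = "pmf (xpair V E J h \<epsilon> \<eta> \<beta> A)"
  let ?F = "temp_filter \<beta>"
  have fin: "finite good_pairs" using finite_pairs by (simp add: good_pairs_def)
  have q: "?q \<omega> = pmf (xprob V E J h \<epsilon> \<eta> \<beta> A 1) (fst \<omega>) * pmf (xprob V E J h \<epsilon> \<eta> \<beta> A (-1)) (snd \<omega>)" for \<omega>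
    by (cases \<omega>) (simp add: xpair_def pmf_pair)
  have lim_q: "((\<lambda>b. pair_prob b \<omega>) \<longlongrightarrow> ?q \<omega>) ?F" if "\<omega> \<in> good_pairs" for \<omega>
  proof -
    have "fst \<omega> \<in> xconfigs V E A 1" "snd \<omega> \<in> xconfigs V E A (-1)"
      using that by (auto simp: good_pairs_def xpair_space_def)
    moreover from this have "?q \<omega> = at_temp \<beta> (\<lambda>b. prob b A 1 (fst \<omega>)) * at_temp \<beta> (\<lambda>b. prob b A (-1) (snd \<omega>))"
      using A_subset \<beta> by (simp add: q pmf_xprob)
    ultimately show ?thesis
      unfolding pair_prob_def using A_subset by (simp only:) (intro tendsto_mult tendsto_prob; simp)
  qed
  have supp: "\<omega> \<in> good_pairs" if "\<omega> \<in> set_pmf (xpair V E J h \<epsilon> \<eta> \<beta> A)" for \<omega>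
  proof -
    have "?q \<omega> \<noteq> 0" using that by (simp add: set_pmf_iff)
    then have "fst \<omega> \<in> xconfigs V E A 1" "snd \<omega> \<in> xconfigs V E A (-1)"
      using A_subset \<beta> by (auto simp: q pmf_xprob split: if_splits)
    then show ?thesis
      using zero that by (auto simp: good_pairs_def xpair_space_def AE_measure_pmf_iff mem_Times_iff)
  qed
  define P where "P b = (\<Sum>\<omega>\<in>good_pairs. pair_prob b \<omega>)" for b
  define N where "N b = (\<Sum>\<omega>\<in>good_pairs. pair_prob b \<omega> * cost \<omega>)" for b
  define M where "M = measure_pmf.expectation (xpair V E J h \<epsilon> \<eta> \<beta> A) (\<lambda>\<omega>. real (cost \<omega>))"
  have "(P \<longlongrightarrow> (\<Sum>\<omega>\<in>good_pairs. ?q \<omega>)) ?F"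
    unfolding P_def by (intro tendsto_sum lim_q)
  then have P: "(P \<longlongrightarrow> 1) ?F"
    using supp by (subst (asm) sum_pmf_eq_1) (auto simp: fin)
  have "(N \<longlongrightarrow> (\<Sum>\<omega>\<in>good_pairs. ?q \<omega> * cost \<omega>)) ?F"
    unfolding N_def by (intro tendsto_sum tendsto_mult lim_q tendsto_const)
  also have "(\<Sum>\<omega>\<in>good_pairs. ?q \<omega> * cost \<omega>) = M"
    unfolding M_def using supp by (subst integral_measure_pmf_real[OF fin]) (auto simp: mult.commute)
  finally have N: "(N \<longlongrightarrow> M) ?F" .
  \<comment> \<open>The factor \<open>1 / b\<close> only needs some limit, as it multiplies
    \<open>ln (P b)\<close>, which tends to 0.\<close>
  have "((\<lambda>b :: real. 1 / b) \<longlongrightarrow> 0) at_top"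
    using tendsto_inverse_0_at_top[OF filterlim_ident] by (simp add: inverse_eq_divide)
  then have "((\<lambda>b. 1 / b) \<longlongrightarrow> at_temp \<beta> (\<lambda>b. 1 / b)) ?F"
    by (rule tendsto_at_temp)
  then have "((\<lambda>b. 4 * \<Delta> * J * (N b / P b) - 1 / b * ln (P b))
      \<longlongrightarrow> 4 * \<Delta> * J * (M / 1) - at_temp \<beta> (\<lambda>b. 1 / b) * ln 1) ?F"
    by (intro tendsto_intros P N) auto
  moreover have "(tension \<longlongrightarrow> surface_tension F V E J h \<epsilon> \<eta> \<Lambda>1 \<Lambda>2 \<beta>) ?F"
    unfolding tension_def by (rule tendsto_surface_tension[OF boundary_subset disjoint])
  moreover have "\<forall>\<^sub>F b in ?F. tension b \<le> 4 * \<Delta> * J * (N b / P b) - 1 / b * ln (P b)"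
    using eventually_temp_filter_pos[OF \<beta>] order_tendstoD(1)[OF P zero_less_one]
    by eventually_elim (simp only: P_def N_def tension_le)
  ultimately have "surface_tension F V E J h \<epsilon> \<eta> \<Lambda>1 \<Lambda>2 \<beta>
      \<le> 4 * \<Delta> * J * (M / 1) - at_temp \<beta> (\<lambda>b. 1 / b) * ln 1"
    by (intro tendsto_le[OF temp_filter_neq_bot])
  then show ?thesis by (simp add: M_def cost_def)
qed

end

theorem proposition4p5:
  fixes VF V :: "'a set" and F E :: "'a set set"
    and J h \<epsilon> :: real and \<beta> :: ereal and \<eta> :: "'a \<Rightarrow> real"
    and \<Lambda>1 \<Lambda>2 :: "'a set"
    and \<S> :: "('a xvert \<Rightarrow> real) \<times> ('a xvert \<Rightarrow> real) \<Rightarrow> 'a xvert set"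
  assumes ambient: "simple_graph VF F"
    and graph: "simple_graph V E" "finite V"
    and subgraph: "V \<subseteq> VF" "E \<subseteq> F"
    and max_degree: "\<And>v. v \<in> V \<Longrightarrow> card {e \<in> E. v \<in> e} \<le> 4"
    and params: "J > 0" "\<epsilon> > 0" "\<beta> > 0"
    and subsets: "\<Lambda>1 \<subseteq> \<Lambda>2" "\<Lambda>2 \<subseteq> V"
    and disjoint_boundaries: "vbd F \<Lambda>1 \<inter> vbd F \<Lambda>2 = {}"
    and separating: "random_separating_set F V E \<Lambda>1 \<Lambda>2 \<S>"
    and non_anticipatory: "non_anticipatory F V E \<Lambda>1 \<Lambda>2 \<S>"
    and zero_midpoints:
      "AE \<omega> in measure_pmf (xpair V E J h \<epsilon> \<eta> \<beta> (vbd F \<Lambda>2 \<union> vbd F \<Lambda>1)).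
         \<forall>e. Mid e \<in> \<S> \<omega> \<longrightarrow> fst \<omega> (Mid e) = 0 \<and> snd \<omega> (Mid e) = 0"
  shows "surface_tension F V E J h \<epsilon> \<eta> \<Lambda>1 \<Lambda>2 \<beta>
    \<le> 16 * J * measure_pmf.expectation (xpair V E J h \<epsilon> \<eta> \<beta> (vbd F \<Lambda>2 \<union> vbd F \<Lambda>1))
          (\<lambda>\<omega>. real (card (\<S> \<omega> \<inter> disagreement V E \<omega>)))"
proof -
  \<comment> \<open>With degree bound 4 the constant \<open>4 * \<Delta>\<close> becomes 16.\<close>
  interpret separated_pair V E J h \<epsilon> \<eta> F \<Lambda>1 \<Lambda>2 4 \<S>
    using graph params(1) max_degree subsets disjoint_boundaries separating non_anticipatory
    by unfold_locales auto
  show ?thesis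
    using surface_tension_le[OF params(3) zero_midpoints] by simp
qed

end
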